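(* Let $\mathcal{F}_H^4$ be the Hesse foliation of degree $4$ on $\mathbb{P}^2_{\mathbb{C}}$ and let $\ell$ be a line of $\mathbb{P}^2_{\mathbb{C}}$ which is not invariant by $\mathcal{F}_H^4$. Assume that the $5$-web $\mathrm{Leg}(\ell\boxtimes\mathcal{F}_H^4)$ is flat. Then the line $\ell$ passes through four (necessarily non-radial) singularities of $\mathcal{F}_H^4$.
   Context: The Hesse foliation $\mathcal F_H^4$ is defined in the affine chart $(x,y)$ by $y(2x^3-y^3-1)\,dx+x(2y^3-x^3-1)\,dy$, i.e. in homogeneous coordinates by $yz(2x^3-y^3-z^3)dx+xz(2y^3-x^3-z^3)dy+xy(2z^3-x^3-y^3)dz$. Its singularities are the zeros in $\mathbb{P}^2_{\mathbb{C}}$ of this 1-form. A singularity $s$ of a foliation, locally defined by a vector field $X$, is radial if the linear part of $X$ at $s$ is a nonzero multiple of the radial field $u\partial_u+v\partial_v$ ($(u,v)$ local coordinates centered at $s$). Pre-foliations. A pre-foliation of co-degree $1$ and degree $d$ on $\mathbb{P}^2_{\mathbb{C}}$ is a pair, written $\ell\boxtimes\mathcal{F}$, of a line $\ell$ and a holomorphic foliation $\mathcal{F}$ of degree $d-1$. Legendre transform. If $\ell\boxtimes\mathcal F$ is given in an affine chart by $f(x,y)(A\,dx+B\,dy)$ ($f=0$ being an equation of $\ell$), then in the affine chart $(p,q)$ of $\check{\mathbb{P}}^2_{\mathbb{C}}$ associated to the line $\{y=px-q\}$, $\mathrm{Leg}(\ell\boxtimes\mathcal F)$ is the $d$-web given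 by $f(x,px-q)\big(A(x,px-q)+pB(x,px-q)\big)=0$ with $x=dq/dp$. Equivalently $\mathrm{Leg}(\ell\boxtimes\mathcal F)=\mathrm{Leg}\,\ell\boxtimes\mathrm{Leg}\,\mathcal F$, where $\mathrm{Leg}\,\ell$ is the pencil of lines through the point $\check\ell$ dual to $\ell$, and the tangents of $\mathrm{Leg}\,\mathcal F$ at a generic $L\in\check{\mathbb{P}}^2_{\mathbb{C}}$ are the lines dual to the tangency points of $L$ with $\mathcal F$. Curvature. At a generic point a $d$-web is a superposition $\mathcal F_1\boxtimes\cdots\boxtimes\mathcal F_d$ of $d$ pairwise transverse foliations, $\mathcal F_i:\omega_i=0$. Put $\omega_i\wedge\omega_j=\delta_{ij}\,dx\wedge dy$. For $r<s<t$ let $\eta_{rst}$ be the unique meromorphic 1-form with $d(\delta_{st}\omega_r)=\eta_{rst}\wedge\delta_{st}\omega_r$, $d(\delta_{tr}\omega_s)=\eta_{rst}\wedge\delta_{tr}\omega_s$, $d(\delta_{rs}\omega_t)=\eta_{rst}\wedge\delta_{rs}\omega_t$. The curvature $K(\mathcal W)=d\big(\sum_{r<s<t}\eta_{rst}\big)$ is a well-defined global meromorphic 2-form; $\mathcal W$ is flat if $K(\mathcal W)\equiv0$. *)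

theory Defs
  imports "HOL-Analysis.Analysis"
begin

section \<open>Points, lines and foliations of the projective plane\<close>

text \<open>A point of the complex projective plane is a one-dimensional subspace of \<open>complex^3\<close>.
  A line is given by the coefficient vector \<open>l \<noteq> 0\<close> of an equation
  \<open>l$1 * x + l$2 * y + l$3 * z = 0\<close>. A foliation is given by a homogeneous 1-form, i.e. by the
  vector \<open>\<Omega> (x,y,z)\<close> of its coefficients with respect to \<open>dx, dy, dz\<close>.\<close>

definition proj_pt :: "complex^3 \<Rightarrow> (complex^3) set" where
  "proj_pt m = vec.span {m}"

definition line_points :: "complex^3 \<Rightarrow> (complex^3) set set" where
  "line_points l = {proj_pt m | m. m \<noteq> 0 \<and> scalar_product l m = 0}"

definition sings :: "(complex^3 \<Rightarrow> complex^3) \<Rightarrow> (complex^3) set set" where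
  "sings \<Omega> = {proj_pt m | m. m \<noteq> 0 \<and> \<Omega> m = 0}"

text \<open>The restriction of \<open>\<Omega>\<close> to the line \<open>l\<close> vanishes at the point \<open>m\<close> of \<open>l\<close>.\<close>

definition tangent_at :: "(complex^3 \<Rightarrow> complex^3) \<Rightarrow> complex^3 \<Rightarrow> complex^3 \<Rightarrow> bool" where
  "tangent_at \<Omega> l m \<longleftrightarrow> (\<forall>w. scalar_product l w = 0 \<longrightarrow> scalar_product (\<Omega> m) w = 0)"

definition invariant_line :: "(complex^3 \<Rightarrow> complex^3) \<Rightarrow> complex^3 \<Rightarrow> bool" where
  "invariant_line \<Omega> l \<longleftrightarrow> (\<forall>m. scalar_product l m = 0 \<longrightarrow> tangent_at \<Omega> l m)"

text \<open>If \<open>m, e, f\<close> is a basis, then \<open>(u,v) \<mapsto> m + u e + v f\<close> gives affine coordinates centered at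
  the point \<open>m\<close>. The form \<open>\<Omega>\<close> pulls back to \<open>a du + b dv\<close> with \<open>a = \<Omega> \<cdot> e\<close> and
  \<open>b = \<Omega> \<cdot> f\<close>, and the foliation is defined by the vector field \<open>b \<partial>u - a \<partial>v\<close>.\<close>

definition local_field ::
  "(complex^3 \<Rightarrow> complex^3) \<Rightarrow> complex^3 \<Rightarrow> complex^3 \<Rightarrow> complex^3 \<Rightarrow> complex \<times> complex \<Rightarrow> complex \<times> complex"
  where
  "local_field \<Omega> m e f = (\<lambda>(u, v).
     (scalar_product (\<Omega> (m + u *s e + v *s f)) f,
      - scalar_product (\<Omega> (m + u *s e + v *s f)) e))"

definition radial_at :: "(complex^3 \<Rightarrow> complex^3) \<Rightarrow> complex^3 \<Rightarrow> bool" where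
  "radial_at \<Omega> m \<longleftrightarrow> \<Omega> m = 0 \<and>
     (\<exists>e f c. det (vector [m, e, f] :: complex^3^3) \<noteq> 0 \<and> c \<noteq> 0 \<and>
        (local_field \<Omega> m e f has_derivative (\<lambda>(h, k). (c * h, c * k))) (at (0, 0)))"

definition radial_sings :: "(complex^3 \<Rightarrow> complex^3) \<Rightarrow> (complex^3) set set" where
  "radial_sings \<Omega> = {proj_pt m | m. m \<noteq> 0 \<and> radial_at \<Omega> m}"

section \<open>Webs on the affine plane and their curvature\<close>

text \<open>A point of the plane is a pair \<open>(p,q)\<close>. The 1-form \<open>a dp + b dq\<close> is the function
  \<open>z \<mapsto> (a z, b z)\<close>, and a 2-form is represented by its coefficient of \<open>dp \<and> dq\<close>.\<close>

type_synonym form1 = "complex \<times> complex \<Rightarrow> complex \<times> complex"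

definition wedge :: "complex \<times> complex \<Rightarrow> complex \<times> complex \<Rightarrow> complex" where
  "wedge \<alpha> \<beta> = fst \<alpha> * snd \<beta> - snd \<alpha> * fst \<beta>"

definition form_apply :: "complex \<times> complex \<Rightarrow> complex \<times> complex \<Rightarrow> complex" where
  "form_apply \<alpha> w = fst \<alpha> * fst w + snd \<alpha> * snd w"

definition form_scale :: "(complex \<times> complex \<Rightarrow> complex) \<Rightarrow> form1 \<Rightarrow> form1" where
  "form_scale g \<omega> = (\<lambda>z. (g z * fst (\<omega> z), g z * snd (\<omega> z)))"

definition ext_d :: "form1 \<Rightarrow> complex \<times> complex \<Rightarrow> complex" where
  "ext_d \<omega> = (\<lambda>(p, q). deriv (\<lambda>t. snd (\<omega> (t, q))) p - deriv (\<lambda>t. fst (\<omega> (p, t))) q)"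

definition holomorphic2_on :: "(complex \<times> complex \<Rightarrow> complex) \<Rightarrow> (complex \<times> complex) set \<Rightarrow> bool" where
  "holomorphic2_on g U \<longleftrightarrow>
     (\<forall>z\<in>U. \<exists>a b. (g has_derivative (\<lambda>(h, k). a * h + b * k)) (at z))"

definition web_delta :: "(nat \<Rightarrow> form1) \<Rightarrow> nat \<Rightarrow> nat \<Rightarrow> complex \<times> complex \<Rightarrow> complex" where
  "web_delta \<omega> i j z = wedge (\<omega> i z) (\<omega> j z)"

definition web_eta :: "(nat \<Rightarrow> form1) \<Rightarrow> nat \<Rightarrow> nat \<Rightarrow> nat \<Rightarrow> form1" where
  "web_eta \<omega> r s t z = (THE \<eta>.
     ext_d (form_scale (web_delta \<omega> s t) (\<omega> r)) z = wedge \<eta> (form_scale (web_delta \<omega> s t) (\<omega> r) z) \<and>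
     ext_d (form_scale (web_delta \<omega> t r) (\<omega> s)) z = wedge \<eta> (form_scale (web_delta \<omega> t r) (\<omega> s) z) \<and>
     ext_d (form_scale (web_delta \<omega> r s) (\<omega> t)) z = wedge \<eta> (form_scale (web_delta \<omega> r s) (\<omega> t) z))"

definition web_curvature :: "nat \<Rightarrow> (nat \<Rightarrow> form1) \<Rightarrow> complex \<times> complex \<Rightarrow> complex" where
  "web_curvature d \<omega> =
     ext_d (\<lambda>z. \<Sum>(r, s, t) \<in> {(r, s, t). r < s \<and> s < t \<and> t < d}. web_eta \<omega> r s t z)"

text \<open>A web is represented by the relation \<open>W\<close> such that \<open>W z w\<close> holds iff the vector \<open>w \<noteq> 0\<close> is
  tangent to the web at \<open>z\<close>. The next predicate says that on the open set \<open>U\<close> it is the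
  superposition of \<open>d\<close> pairwise transverse foliations \<open>\<omega> 0 = 0, \<dots>, \<omega> (d - 1) = 0\<close>.\<close>

definition web_decomposition ::
  "nat \<Rightarrow> (complex \<times> complex \<Rightarrow> complex \<times> complex \<Rightarrow> bool) \<Rightarrow> (complex \<times> complex) set
    \<Rightarrow> (nat \<Rightarrow> form1) \<Rightarrow> bool" where
  "web_decomposition d W U \<omega> \<longleftrightarrow> open U \<and>
     (\<forall>i<d. holomorphic2_on (\<lambda>z. fst (\<omega> i z)) U \<and> holomorphic2_on (\<lambda>z. snd (\<omega> i z)) U) \<and>
     (\<forall>z\<in>U. \<forall>i<d. \<forall>j<d. i \<noteq> j \<longrightarrow> web_delta \<omega> i j z \<noteq> 0) \<and>
     (\<forall>z\<in>U. \<forall>w. w \<noteq> (0, 0) \<longrightarrow> (W z w \<longleftrightarrow> (\<exists>i<d. form_apply (\<omega> i z) w = 0)))"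

text \<open>The curvature of a \<open>d\<close>-web does not depend on the decomposition and is meromorphic, so it is
  identically zero iff it vanishes wherever the web is locally decomposed.\<close>

definition flat_web :: "nat \<Rightarrow> (complex \<times> complex \<Rightarrow> complex \<times> complex \<Rightarrow> bool) \<Rightarrow> bool" where
  "flat_web d W \<longleftrightarrow>
     (\<forall>U \<omega>. web_decomposition d W U \<omega> \<longrightarrow> (\<forall>z\<in>U. web_curvature d \<omega> z = 0))"

section \<open>Legendre transform\<close>

text \<open>The pair \<open>(p,q)\<close> stands for the line \<open>L = {y = p x - q}\<close>. A direction \<open>(u,v)\<close> in
  coordinates \<open>(dp,dq)\<close> at \<open>(p,q)\<close> is the direction of the line dual to the point of \<open>L\<close> with
  \<open>(x : z) = (v : u)\<close>, i.e. \<open>x = dq/dp\<close> in the chart \<open>z = 1\<close>; using \<open>(u,v)\<close> instead of \<open>x\<close>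
  includes the point of \<open>L\<close> at infinity.\<close>

definition dual_line :: "complex \<times> complex \<Rightarrow> complex^3" where
  "dual_line = (\<lambda>(p, q). vector [p, -1, -q])"

definition dual_dir_point :: "complex \<times> complex \<Rightarrow> complex \<times> complex \<Rightarrow> complex^3" where
  "dual_dir_point = (\<lambda>(p, q) (u, v). vector [v, p * v - q * u, u])"

definition Leg :: "complex^3 \<Rightarrow> (complex^3 \<Rightarrow> complex^3) \<Rightarrow>
    complex \<times> complex \<Rightarrow> complex \<times> complex \<Rightarrow> bool" where
  "Leg l \<Omega> = (\<lambda>z w. scalar_product l (dual_dir_point z w) = 0 \<or>
     tangent_at \<Omega> (dual_line z) (dual_dir_point z w))"

text \<open>In the chart \<open>z = 1\<close>, with \<open>x = dq/dp\<close>, this is the implicit differential equation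
  \<open>f (x, p x - q) (A (x, p x - q) + p B (x, p x - q)) = 0\<close>.\<close>

lemma Leg_affine:
  assumes euler: "\<And>m. scalar_product (\<Omega> m) m = 0"
  shows "Leg l \<Omega> (p, q) (1, x) \<longleftrightarrow>
    (l$1 * x + l$2 * (p * x - q) + l$3) *
    (\<Omega> (vector [x, p * x - q, 1]) $ 1 + p * \<Omega> (vector [x, p * x - q, 1]) $ 2) = 0"
proof -
  define m :: "complex^3" where "m = vector [x, p * x - q, 1]"
  have m: "m$1 = x" "m$2 = p * x - q" "m$3 = 1"
    by (simp_all add: m_def)
  have e: "\<Omega> m $ 3 = - (\<Omega> m $ 1 * x + \<Omega> m $ 2 * (p * x - q))"
    using euler[of m] by (simp add: scalar_product_def sum_3 m add_eq_0_iff)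
  have tan: "tangent_at \<Omega> (vector [p, -1, -q]) m \<longleftrightarrow> \<Omega> m $ 1 + p * \<Omega> m $ 2 = 0"
  proof
    assume "tangent_at \<Omega> (vector [p, -1, -q]) m"
    moreover have "scalar_product (vector [p, -1, -q] :: complex^3) (vector [1, p, 0]) = 0"
      by (simp add: scalar_product_def sum_3)
    ultimately have "scalar_product (\<Omega> m) (vector [1, p, 0]) = 0"
      unfolding tangent_at_def by blast
    then show "\<Omega> m $ 1 + p * \<Omega> m $ 2 = 0"
      by (simp add: scalar_product_def sum_3 mult.commute)
  next
    assume "\<Omega> m $ 1 + p * \<Omega> m $ 2 = 0"
    then have a: "\<Omega> m $ 1 = - (p * \<Omega> m $ 2)"
      by (simp add: add_eq_0_iff)
    show "tangent_at \<Omega> (vector [p, -1, -q]) m"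
      unfolding tangent_at_def
    proof (intro allI impI)
      fix w :: "complex^3"
      assume "scalar_product (vector [p, -1, -q]) w = 0"
      then have w2: "w$2 = p * w$1 - q * w$3"
        by (simp add: scalar_product_def sum_3 algebra_simps)
      show "scalar_product (\<Omega> m) w = 0"
        by (simp add: scalar_product_def sum_3 a e w2 algebra_simps)
    qed
  qed
  show ?thesis
    using tan by (simp add: Leg_def dual_line_def dual_dir_point_def scalar_product_def sum_3 m_def)
qed

section \<open>The Hesse foliation\<close>

definition hesse :: "complex^3 \<Rightarrow> complex^3" where
  "hesse m = (let x = m$1; y = m$2; z = m$3 in
     vector [y * z * (2 * x^3 - y^3 - z^3),
             x * z * (2 * y^3 - x^3 - z^3),
             x * y * (2 * z^3 - x^3 - y^3)])"

lemma hesse_euler: "scalar_product (hesse m) m = 0"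
  by (simp add: hesse_def Let_def scalar_product_def sum_3 algebra_simps)

lemma hesse_homogeneous: "hesse (c *s m) = c^5 *s hesse m"
  by (simp add: hesse_def Let_def vec_eq_iff forall_3 power_mult_distrib algebra_simps
      eval_nat_numeral)

end

theory Submission
  imports Defs "HOL-Computational_Algebra.Fundamental_Theorem_Algebra"
begin

text \<open>For a generic point \<open>m\<close> of the line, let \<open>L\<close> be the tangent at \<open>m\<close> of the foliation. Near \<open>L\<close> the
  web consists of the pencil dual to the line and of four foliations given by the simple roots of the
  quartic \<open>P = A + p B\<close>, one of which touches the pencil along a curve through \<open>L\<close>. The curvature has
  at most a double pole along this curve, and flatness forces its leading coefficient to vanish.
  Written with \<open>P\<close>, this is an equation in \<open>m\<close> that contains the inflection polynomial
  \<open>x y z ((x\<^sup>3 + y\<^sup>3 + z\<^sup>3)\<^sup>3 - 27 x\<^sup>3 y\<^sup>3 z\<^sup>3)\<close> of the foliation as a factor. After cancelling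
  it, one finds that
  \<open>a x (x\<^sup>6 - 7 y\<^sup>3 z\<^sup>3) + b y (y\<^sup>6 - 7 x\<^sup>3 z\<^sup>3) + c z (z\<^sup>6 - 7 x\<^sup>3 y\<^sup>3)\<close>
  vanishes on the line \<open>a x + b y + c z = 0\<close>. This happens only for the twelve invariant lines and for the
  nine lines such as \<open>y = k x\<close> with \<open>k\<^sup>3 = 1\<close>. On the latter the singularities can be listed;
  they are not radial because there the form is closed to first order.\<close>

section \<open>Functions with continuous partial derivatives\<close>

text \<open>The tangent line \<open>L\<close> is a point where the web is not decomposed, because
  two slopes agree there, so flatness says nothing at \<open>L\<close> itself. The square of the
  slope difference times the curvature does extend continuously, and it vanishes off the coincidence
  curve; this curve has empty interior near \<open>L\<close> whenever the slope difference has
  nonzero derivative there. Three of the slopes at \<open>L\<close> are the unknown remaining roots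
  of the quartic. They enter the leading coefficient only through the sum of the
  \<open>1 / (r - r_j)\<close>, which is \<open>P'' / (2 P')\<close> at the root \<open>r\<close>,
  so the condition becomes polynomial in the coordinates of \<open>m\<close>. The inflection
  polynomial enters twice: through \<open>P'\<close>, since a double root is a contact of higher
  order, and through \<open>A ^ 3 - B ^ 3\<close>, which comes from \<open>P''\<close>. No theory of
  holomorphic functions of two variables is used: the branches come from the continuity of roots,
  and every function carries explicit partial derivatives.\<close>

definition has_partials :: "(complex \<times> complex) set \<Rightarrow> (complex \<times> complex \<Rightarrow> complex) \<Rightarrow>
    (complex \<times> complex \<Rightarrow> complex) \<Rightarrow> (complex \<times> complex \<Rightarrow> complex) \<Rightarrow> bool" where
  "has_partials V f fp fq \<longleftrightarrow>
     (\<forall>z\<in>V. (f has_derivative (\<lambda>w. fp z * fst w + fq z * snd w)) (at z))"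

lemma has_partials_const: "has_partials V (\<lambda>z. c) (\<lambda>z. 0) (\<lambda>z. 0)"
  by (auto simp: has_partials_def)

lemma has_partials_fst: "has_partials V fst (\<lambda>z. 1) (\<lambda>z. 0)"
  by (auto simp: has_partials_def intro!: derivative_eq_intros)

lemma has_partials_snd: "has_partials V snd (\<lambda>z. 0) (\<lambda>z. 1)"
  by (auto simp: has_partials_def intro!: derivative_eq_intros)

lemma has_partials_add:
  assumes "has_partials V f fp fq" "has_partials V g gp gq"
  shows "has_partials V (\<lambda>z. f z + g z) (\<lambda>z. fp z + gp z) (\<lambda>z. fq z + gq z)"
  unfolding has_partials_def
proof
  fix z assume z: "z \<in> V"
  show "((\<lambda>z. f z + g z) has_derivative (\<lambda>w. (fp z + gp z) * fst w + (fq z + gq z) * snd w)) (at z)"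
    by (rule has_derivative_eq_rhs[OF has_derivative_add[OF assms[unfolded has_partials_def, rule_format, OF z]]])
      (auto simp: algebra_simps)
qed

lemma has_partials_minus:
  assumes "has_partials V f fp fq"
  shows "has_partials V (\<lambda>z. - f z) (\<lambda>z. - fp z) (\<lambda>z. - fq z)"
  unfolding has_partials_def
proof
  fix z assume z: "z \<in> V"
  show "((\<lambda>z. - f z) has_derivative (\<lambda>w. - fp z * fst w + - fq z * snd w)) (at z)"
    by (rule has_derivative_eq_rhs[OF has_derivative_minus[OF assms[unfolded has_partials_def, rule_format, OF z]]])
      (auto simp: algebra_simps)
qed

lemma has_partials_diff:
  assumes "has_partials V f fp fq" "has_partials V g gp gq"
  shows "has_partials V (\<lambda>z. f z - g z) (\<lambda>z. fp z - gp z) (\<lambda>z. fq z - gq z)"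
  using has_partials_add[OF assms(1) has_partials_minus[OF assms(2)]] by simp

lemma has_partials_mult:
  assumes "has_partials V f fp fq" "has_partials V g gp gq"
  shows "has_partials V (\<lambda>z. f z * g z) (\<lambda>z. fp z * g z + f z * gp z) (\<lambda>z. fq z * g z + f z * gq z)"
  unfolding has_partials_def
proof
  fix z assume z: "z \<in> V"
  show "((\<lambda>z. f z * g z) has_derivative
      (\<lambda>w. (fp z * g z + f z * gp z) * fst w + (fq z * g z + f z * gq z) * snd w)) (at z)"
    by (rule has_derivative_eq_rhs[OF has_derivative_mult[OF assms[unfolded has_partials_def, rule_format, OF z]]])
      (auto simp: algebra_simps)
qed

lemma has_partials_inverse:
  assumes "has_partials V f fp fq" "\<And>z. z \<in> V \<Longrightarrow> f z \<noteq> 0"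
  shows "has_partials V (\<lambda>z. inverse (f z)) (\<lambda>z. - fp z / (f z)\<^sup>2) (\<lambda>z. - fq z / (f z)\<^sup>2)"
  unfolding has_partials_def
proof
  fix z assume z: "z \<in> V"
  show "((\<lambda>z. inverse (f z)) has_derivative
      (\<lambda>w. - fp z / (f z)\<^sup>2 * fst w + - fq z / (f z)\<^sup>2 * snd w)) (at z)"
    by (rule has_derivative_eq_rhs[OF Deriv.has_derivative_inverse[OF assms(2)[OF z]
            assms(1)[unfolded has_partials_def, rule_format, OF z]]])
      (use assms(2)[OF z] in \<open>auto simp: field_simps power2_eq_square\<close>)
qed

lemma has_partials_continuous_on: "has_partials V f fp fq \<Longrightarrow> continuous_on V f"
  unfolding has_partials_def
  by (blast intro: continuous_at_imp_continuous_on has_derivative_continuous)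

lemma has_partials_subset: "has_partials V f fp fq \<Longrightarrow> U \<subseteq> V \<Longrightarrow> has_partials U f fp fq"
  by (auto simp: has_partials_def)

lemma has_partials_deriv_fst:
  assumes "has_partials V f fp fq" "(p, q) \<in> V"
  shows "((\<lambda>t. f (t, q)) has_field_derivative fp (p, q)) (at p)"
proof -
  have "(f has_derivative (\<lambda>w. fp (p, q) * fst w + fq (p, q) * snd w)) (at (p, q))"
    using assms by (auto simp: has_partials_def)
  moreover have "((\<lambda>t. (t, q)) has_derivative (\<lambda>h. (h, 0))) (at p)"
    by (auto intro!: derivative_eq_intros)
  ultimately have "((\<lambda>t. f (t, q)) has_derivative (\<lambda>h. fp (p, q) * fst (h, 0::complex) + fq (p, q) * snd (h, 0::complex))) (at p)"
    using has_derivative_compose[of "\<lambda>t. (t, q)" "\<lambda>h. (h, 0)" p UNIV f] by blast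
  then show ?thesis
    by (simp add: has_field_derivative_def)
qed

lemma has_partials_deriv_snd:
  assumes "has_partials V f fp fq" "(p, q) \<in> V"
  shows "((\<lambda>t. f (p, t)) has_field_derivative fq (p, q)) (at q)"
proof -
  have "(f has_derivative (\<lambda>w. fp (p, q) * fst w + fq (p, q) * snd w)) (at (p, q))"
    using assms by (auto simp: has_partials_def)
  moreover have "((\<lambda>t. (p, t)) has_derivative (\<lambda>h. (0, h))) (at q)"
    by (auto intro!: derivative_eq_intros)
  ultimately have "((\<lambda>t. f (p, t)) has_derivative (\<lambda>h. fp (p, q) * fst (0::complex, h) + fq (p, q) * snd (0::complex, h))) (at q)"
    using has_derivative_compose[of "\<lambda>t. (p, t)" "\<lambda>h. (0, h)" q UNIV f] by blast
  then show ?thesis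
    by (simp add: has_field_derivative_def)
qed

lemma ext_d_has_partials:
  assumes "has_partials V f fp fq" "has_partials V g gp gq" "z \<in> V"
  shows "ext_d (\<lambda>z. (f z, g z)) z = gp z - fq z"
proof (cases z)
  case (Pair p q)
  with assms show ?thesis
    by (auto simp: ext_d_def intro!: arg_cong2[where f = "(-)"] DERIV_imp_deriv
        has_partials_deriv_fst has_partials_deriv_snd)
qed

lemma ext_d_cong_open:
  assumes "open U" "z \<in> U" and eq: "\<And>w. w \<in> U \<Longrightarrow> \<alpha> w = \<beta> w"
  shows "ext_d \<alpha> z = ext_d \<beta> z"
proof (cases z)
  case (Pair p q)
  have "open ((\<lambda>t. (t, q)) -` U)" "open ((\<lambda>t. (p, t)) -` U)"
    by (intro open_vimage assms continuous_on_Pair continuous_on_id continuous_on_const)+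
  then have "eventually (\<lambda>t. (t, q) \<in> U) (nhds p)" "eventually (\<lambda>t. (p, t) \<in> U) (nhds q)"
    using assms(2) Pair unfolding eventually_nhds vimage_def by blast+
  then show ?thesis
    unfolding ext_d_def Pair prod.case
    by (auto intro!: arg_cong2[where f = "(-)"] deriv_cong_ev elim!: eventually_mono simp: eq)
qed

text \<open>Continuity of the partials is built in: the limit of the curvature at a point of the
  coincidence curve involves derivatives of the regular part of \<eta>, and these must stay bounded
  there.\<close>

definition C1 :: "(complex \<times> complex) set \<Rightarrow> (complex \<times> complex \<Rightarrow> complex) \<Rightarrow> bool" where
  "C1 V f \<longleftrightarrow> (\<exists>fp fq. has_partials V f fp fq \<and> continuous_on V fp \<and> continuous_on V fq)"

named_theorems C1_intros

lemma C1I: "has_partials V f fp fq \<Longrightarrow> continuous_on V fp \<Longrightarrow> continuous_on V fq \<Longrightarrow> C1 V f"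
  by (auto simp: C1_def)

lemma C1_continuous_on: "C1 V f \<Longrightarrow> continuous_on V f"
  using has_partials_continuous_on by (auto simp: C1_def)

lemma C1_subset: "C1 V f \<Longrightarrow> U \<subseteq> V \<Longrightarrow> C1 U f"
  unfolding C1_def using has_partials_subset continuous_on_subset by metis

lemma C1_const [C1_intros]: "C1 V (\<lambda>z. c)"
  unfolding C1_def using has_partials_const by (metis continuous_on_const)

lemma C1_fst [C1_intros]: "C1 V fst"
  unfolding C1_def using has_partials_fst by (metis continuous_on_const)

lemma C1_snd [C1_intros]: "C1 V snd"
  unfolding C1_def using has_partials_snd by (metis continuous_on_const)

lemma C1_add [C1_intros]:
  assumes "C1 V f" "C1 V g" shows "C1 V (\<lambda>z. f z + g z)"
proof -
  obtain fp fq gp gq where f: "has_partials V f fp fq" and g: "has_partials V g gp gq"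
    and "continuous_on V fp" "continuous_on V fq" "continuous_on V gp" "continuous_on V gq"
    using assms by (auto simp: C1_def)
  then show ?thesis
    by (intro C1I[OF has_partials_add[OF f g]] continuous_on_add)
qed

lemma C1_minus [C1_intros]:
  assumes "C1 V f" shows "C1 V (\<lambda>z. - f z)"
proof -
  obtain fp fq where f: "has_partials V f fp fq" and "continuous_on V fp" "continuous_on V fq"
    using assms by (auto simp: C1_def)
  then show ?thesis
    by (intro C1I[OF has_partials_minus[OF f]] continuous_on_minus)
qed

lemma C1_diff [C1_intros]: "C1 V f \<Longrightarrow> C1 V g \<Longrightarrow> C1 V (\<lambda>z. f z - g z)"
  using C1_add[of V f "\<lambda>z. - g z"] C1_minus[of V g] by simp

lemma C1_mult [C1_intros]:
  assumes "C1 V f" "C1 V g" shows "C1 V (\<lambda>z. f z * g z)"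
proof -
  obtain fp fq gp gq where f: "has_partials V f fp fq" and g: "has_partials V g gp gq"
    and "continuous_on V fp" "continuous_on V fq" "continuous_on V gp" "continuous_on V gq"
    using assms by (auto simp: C1_def)
  moreover have "continuous_on V f" "continuous_on V g"
    using assms C1_continuous_on by auto
  ultimately show ?thesis
    by (intro C1I[OF has_partials_mult[OF f g]] continuous_on_add continuous_on_mult)
qed

lemma C1_inverse:
  assumes "C1 V f" "\<And>z. z \<in> V \<Longrightarrow> f z \<noteq> 0" shows "C1 V (\<lambda>z. inverse (f z))"
proof -
  obtain fp fq where f: "has_partials V f fp fq" "continuous_on V fp" "continuous_on V fq"
    using assms(1) by (auto simp: C1_def)
  have "continuous_on V f"
    using assms C1_continuous_on by auto
  then have "continuous_on V (\<lambda>z. - fp z / (f z)\<^sup>2)" "continuous_on V (\<lambda>z. - fq z / (f z)\<^sup>2)"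
    using f assms(2) by (intro continuous_on_divide continuous_on_minus continuous_on_power; simp)+
  then show ?thesis
    unfolding C1_def using has_partials_inverse[OF f(1) assms(2)] by blast
qed

lemma C1_divide [C1_intros]:
  "C1 V f \<Longrightarrow> C1 V g \<Longrightarrow> (\<And>z. z \<in> V \<Longrightarrow> g z \<noteq> 0) \<Longrightarrow> C1 V (\<lambda>z. f z / g z)"
  unfolding divide_inverse by (intro C1_mult C1_inverse)

lemma C1_sum [C1_intros]:
  "finite I \<Longrightarrow> (\<And>i. i \<in> I \<Longrightarrow> C1 V (f i)) \<Longrightarrow> C1 V (\<lambda>z. \<Sum>i\<in>I. f i z)"
  by (induction I rule: finite_induct) (simp_all add: C1_const C1_add)

lemma C1_power [C1_intros]: "C1 V f \<Longrightarrow> C1 V (\<lambda>z. f z ^ n)"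
  by (induction n) (simp_all add: C1_const C1_mult)

section \<open>The curvature near a tangency of two foliations of the web\<close>

text \<open>Foliation \<open>i\<close> is \<open>dq = x i dp\<close>, with \<open>a i\<close> and
  \<open>b i\<close> the partials of its slope; the number 5 counts the pencil and the four
  branches. The partials are themselves \<open>C1\<close> because \<eta> contains first derivatives
  of the slopes and the curvature differentiates \<eta>.\<close>

locale slopes =
  fixes V :: "(complex \<times> complex) set" and x a b :: "nat \<Rightarrow> complex \<times> complex \<Rightarrow> complex"
  assumes open_V: "open V"
    and partials: "\<And>i. i < 5 \<Longrightarrow> has_partials V (x i) (a i) (b i)"
    and C1_a: "\<And>i. i < 5 \<Longrightarrow> C1 V (a i)"
    and C1_b: "\<And>i. i < 5 \<Longrightarrow> C1 V (b i)"
begin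

definition form :: "nat \<Rightarrow> form1" where
  "form i = (\<lambda>z. (- x i z, 1))"

text \<open>The coefficient of \<open>d (\<delta>_st \<omega>_r)\<close> divided by
  \<open>\<delta>_st\<close>, which for these forms is \<open>x t - x s\<close>. After this division
  the condition on \<eta> prescribes its value on the tangent vector \<open>(1, x r)\<close> of
  foliation \<open>r\<close>.\<close>

definition N :: "nat \<Rightarrow> nat \<Rightarrow> nat \<Rightarrow> complex \<times> complex \<Rightarrow> complex" where
  "N r s t z = (a t z - a s z + x r z * (b t z - b s z)) / (x t z - x s z) + b r z"

text \<open>The three equations for \<open>\<eta> = eta1 dp + eta2 dq\<close> read \<open>eta1 + eta2 * x r = N r s t\<close> and its
  cyclic permutations. Their weighted sum is trivial, so two of them determine \<open>\<eta>\<close>.\<close>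

definition eta2 :: "nat \<Rightarrow> nat \<Rightarrow> nat \<Rightarrow> complex \<times> complex \<Rightarrow> complex" where
  "eta2 r s t z = (N r s t z - N t r s z) / (x r z - x t z)"

definition eta1 :: "nat \<Rightarrow> nat \<Rightarrow> nat \<Rightarrow> complex \<times> complex \<Rightarrow> complex" where
  "eta1 r s t z = N r s t z - x r z * eta2 r s t z"

lemma C1_x: "i < 5 \<Longrightarrow> C1 V (x i)"
  unfolding C1_def using partials C1_a C1_b C1_continuous_on by blast

lemma ext_d_scaled_form:
  assumes "z \<in> V" "r < 5" "s < 5" "t < 5"
  shows "ext_d (form_scale (web_delta form s t) (form r)) z =
    a t z - a s z + (b t z - b s z) * x r z + (x t z - x s z) * b r z"
proof -
  have "ext_d (form_scale (web_delta form s t) (form r)) z =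
      ext_d (\<lambda>z. (- ((x t z - x s z) * x r z), x t z - x s z)) z"
    by (simp add: form_scale_def web_delta_def wedge_def form_def)
  also have "\<dots> = a t z - a s z - (- ((b t z - b s z) * x r z + (x t z - x s z) * b r z))"
    by (rule ext_d_has_partials[OF has_partials_minus[OF has_partials_mult[OF has_partials_diff]]
          has_partials_diff]) (rule partials assms)+
  finally show ?thesis by simp
qed

lemma web_eta_form:
  assumes z: "z \<in> V" and rst: "r < 5" "s < 5" "t < 5"
    and ne: "x r z \<noteq> x s z" "x s z \<noteq> x t z" "x r z \<noteq> x t z"
  shows "web_eta form r s t z = (eta1 r s t z, eta2 r s t z)"
proof -
  let ?P = "\<lambda>r s t \<eta>. ext_d (form_scale (web_delta form s t) (form r)) z =
      wedge \<eta> (form_scale (web_delta form s t) (form r) z)"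
  have N: "(x t z - x s z) * N r s t z = a t z - a s z + (b t z - b s z) * x r z + (x t z - x s z) * b r z"
    if "x s z \<noteq> x t z" for r s t
    using that by (simp add: N_def field_simps)
  have P: "?P r s t \<eta> \<longleftrightarrow> fst \<eta> + snd \<eta> * x r z = N r s t z"
    if "r < 5" "s < 5" "t < 5" "x s z \<noteq> x t z" for r s t and \<eta> :: "complex \<times> complex"
  proof -
    have "wedge \<eta> (form_scale (web_delta form s t) (form r) z) =
        (x t z - x s z) * (fst \<eta> + snd \<eta> * x r z)"
      by (simp add: form_scale_def web_delta_def wedge_def form_def algebra_simps)
    then have "?P r s t \<eta> \<longleftrightarrow> (x t z - x s z) * (fst \<eta> + snd \<eta> * x r z) = (x t z - x s z) * N r s t z"
      unfolding ext_d_scaled_form[OF z that(1-3)] N[OF that(4)] by auto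
    then show ?thesis using that by auto
  qed
  \<comment> \<open>The forms \<open>\<delta>_st \<omega>_r\<close>,
    \<open>\<delta>_tr \<omega>_s\<close> and \<open>\<delta>_rs \<omega>_t\<close> add up to zero,
    hence so do their exterior derivatives; this yields the equation for \<open>s\<close> from the
    other two.\<close>
  have sumN: "(x t z - x s z) * N r s t z + (x r z - x t z) * N s t r z + (x s z - x r z) * N t r s z = 0"
    unfolding N[OF ne(2)] N[OF ne(3)[symmetric]] N[OF ne(1)] by (simp add: algebra_simps)
  have e2: "(x r z - x t z) * eta2 r s t z = N r s t z - N t r s z"
    using ne by (simp add: eta2_def)
  show ?thesis
    unfolding web_eta_def
  proof (rule the_equality)
    have "fst (eta1 r s t z, eta2 r s t z) + snd (eta1 r s t z, eta2 r s t z) * x r z = N r s t z"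
      by (simp add: eta1_def)
    moreover have 2: "eta1 r s t z + eta2 r s t z * x t z = N t r s z"
      using e2 by (simp add: eta1_def algebra_simps)
    moreover have "eta1 r s t z + eta2 r s t z * x s z = N s t r z"
    proof -
      have "(x r z - x t z) * (eta1 r s t z + eta2 r s t z * x s z) = (x r z - x t z) * N s t r z"
        using sumN e2 by (simp add: eta1_def) algebra
      then show ?thesis using ne by simp
    qed
    ultimately show "?P r s t (eta1 r s t z, eta2 r s t z) \<and> ?P s t r (eta1 r s t z, eta2 r s t z) \<and>
        ?P t r s (eta1 r s t z, eta2 r s t z)"
      using P rst ne by simp
  next
    fix \<eta> assume "?P r s t \<eta> \<and> ?P s t r \<eta> \<and> ?P t r s \<eta>"
    then have 1: "fst \<eta> + snd \<eta> * x r z = N r s t z" "fst \<eta> + snd \<eta> * x t z = N t r s z"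
      using P rst ne by (metis)+
    have "(x r z - x t z) * snd \<eta> = (x r z - x t z) * eta2 r s t z"
      unfolding e2 using 1 by (simp add: algebra_simps flip: 1)
    then have "snd \<eta> = eta2 r s t z" using ne by simp
    moreover then have "fst \<eta> = eta1 r s t z" using 1 by (simp add: eta1_def algebra_simps flip: 1(1))
    ultimately show "\<eta> = (eta1 r s t z, eta2 r s t z)" by (simp add: prod_eq_iff)
  qed
qed

end

context slopes begin

lemma C1_N:
  assumes "U \<subseteq> V" "r < 5" "s < 5" "t < 5" "\<And>z. z \<in> U \<Longrightarrow> x t z - x s z \<noteq> 0"
  shows "C1 U (N r s t)"
  unfolding N_def[abs_def] using assms
  by (intro C1_intros C1_subset[OF C1_x assms(1)] C1_subset[OF C1_a assms(1)] C1_subset[OF C1_b assms(1)]) auto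

end

text \<open>With \<open>t = x 0 - x 1\<close>, only the three 3-webs containing the foliations 0 and 1 contribute
  a pole along \<open>t = 0\<close>, and the sum of all \<open>\<eta>\<close> is \<open>- \<beta> / t\<close> times the form 0 plus a
  \<open>C1\<close> form. The conclusion says that the coefficient of \<open>t\<close> to the power -2 in the curvature
  vanishes at \<open>z0\<close>.\<close>

theorem (in slopes) curvature_residue:
  assumes transverse: "\<And>i j z. i < j \<Longrightarrow> j < 5 \<Longrightarrow> (i, j) \<noteq> (0, 1) \<Longrightarrow> z \<in> V \<Longrightarrow> x i z \<noteq> x j z"
    and z0: "z0 \<in> V" "x 0 z0 = x 1 z0"
    and flat: "\<And>z. z \<in> V \<Longrightarrow> x 0 z \<noteq> x 1 z \<Longrightarrow> web_curvature 5 form z = 0"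
  shows "(a 0 z0 - a 1 z0 + x 0 z0 * (b 0 z0 - b 1 z0)) *
    (\<Sum>j\<in>{2,3,4}. (a 0 z0 - a 1 z0 + x j z0 * (b 0 z0 - b 1 z0)) / (x 0 z0 - x j z0)) = 0"
proof -
  have ne: "x i z - x j z \<noteq> 0" if "i < 5" "j < 5" "i \<noteq> j" "{i, j} \<noteq> {0, 1}" "z \<in> V" for i j z
  proof (cases "i < j")
    case True
    with transverse[of i j z] that show ?thesis by auto
  next
    case False
    then have "j < i" "(j, i) \<noteq> (0, 1)" using that by (auto simp: doubleton_eq_iff)
    with transverse[of j i z] that show ?thesis by auto
  qed
  define \<beta> where "\<beta> z = (\<Sum>j\<in>{2,3,4}. (a 0 z - a 1 z + x j z * (b 0 z - b 1 z)) / (x 0 z - x j z))" for z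
  define t where "t z = x 0 z - x 1 z" for z
  \<comment> \<open>The seven triples that do not contain both 0 and 1, so that no denominator of
    their \<eta> vanishes on \<open>V\<close>.\<close>
  define R where "R = {(0::nat,2::nat,3::nat), (0,2,4), (0,3,4), (1,2,3), (1,2,4), (1,3,4), (2,3,4)}"
  \<comment> \<open>In the triple \<open>(0, 1, j)\<close> the pole of \<open>eta2\<close> comes
    only from \<open>N j 0 1\<close>; \<open>h2\<close> keeps the regular rest. Since
    \<open>eta1\<close> is \<open>N 0 1 j - x 0 * eta2\<close> with \<open>N 0 1 j\<close> regular,
    the polar part of \<eta> is a multiple of the form 0.\<close>
  define h2 where "h2 z = (\<Sum>j\<in>{2,3,4}. (N 0 1 j z - b j z) / (x 0 z - x j z))" for z
  define g2 where "g2 z = h2 z + (\<Sum>(r, s, t)\<in>R. eta2 r s t z)" for z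
  define g1 where "g1 z = (\<Sum>j\<in>{2,3,4}. N 0 1 j z) - x 0 z * h2 z + (\<Sum>(r, s, t)\<in>R. eta1 r s t z)" for z
  note C1V = C1_x C1_a C1_b
  have C1_beta: "C1 V \<beta>"
    unfolding \<beta>_def[abs_def] by (intro C1_intros C1V ne) (auto simp: doubleton_eq_iff)
  have C1_N': "C1 V (N r s t)" if "r < 5" "s < 5" "t < 5" "s \<noteq> t" "{s, t} \<noteq> {0, 1}" for r s t
    using that by (intro C1_N ne) (auto simp: doubleton_eq_iff)
  have C1_h2: "C1 V h2"
    unfolding h2_def[abs_def] by (intro C1_intros C1V C1_N' ne) (auto simp: doubleton_eq_iff)
  have C1_eta2: "C1 V (eta2 r s t)" if "(r, s, t) \<in> R" for r s t
    using that unfolding eta2_def[abs_def]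
    by (intro C1_intros C1_N' C1_x ne) (auto simp: doubleton_eq_iff R_def)
  have C1_eta1: "C1 V (eta1 r s t)" if "(r, s, t) \<in> R" for r s t
    using that unfolding eta1_def[abs_def]
    by (intro C1_intros C1_N' C1_x C1_eta2) (auto simp: doubleton_eq_iff R_def)
  have finR: "finite R" by (simp add: R_def)
  have "C1 V g2"
    unfolding g2_def[abs_def] using C1_eta2
    by (intro C1_add C1_h2 C1_sum finR) auto
  then obtain g2p g2q where g2: "has_partials V g2 g2p g2q" "continuous_on V g2p"
    by (auto simp: C1_def)
  have "C1 V g1"
    unfolding g1_def[abs_def] using C1_eta1
    by (intro C1_add C1_diff C1_mult C1_h2 C1_x C1_sum C1_N' finR) (auto simp: doubleton_eq_iff)
  then obtain g1p g1q where g1: "has_partials V g1 g1p g1q" "continuous_on V g1q"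
    by (auto simp: C1_def)
  obtain \<beta>p \<beta>q where \<beta>: "has_partials V \<beta> \<beta>p \<beta>q" "continuous_on V \<beta>p" "continuous_on V \<beta>q"
    using C1_beta by (auto simp: C1_def)
  have t: "has_partials V t (\<lambda>z. a 0 z - a 1 z) (\<lambda>z. b 0 z - b 1 z)"
    unfolding t_def[abs_def] by (intro has_partials_diff partials) auto
  \<comment> \<open>This is minus \<open>t ^ 2\<close> times the curvature, expanded so that no
    division by \<open>t\<close> remains. At \<open>z0\<close> only the middle term
    survives.\<close>
  define \<Psi> where "\<Psi> z = t z * (\<beta>p z + b 0 z * \<beta> z + x 0 z * \<beta>q z)
      - \<beta> z * (a 0 z - a 1 z + x 0 z * (b 0 z - b 1 z)) - (t z)\<^sup>2 * (g2p z - g1q z)" for z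
  define U where "U = {z \<in> V. t z \<noteq> 0}"
  have cont_t: "continuous_on V t"
    using t by (rule has_partials_continuous_on)
  have open_U: "open U"
  proof -
    have "U = V \<inter> t -` (- {0})" by (auto simp: U_def)
    then show ?thesis using continuous_open_preimage[OF cont_t open_V, of "- {0}"] by auto
  qed
  have UV: "U \<subseteq> V" by (auto simp: U_def)
  have triples: "{(r, s, t). r < s \<and> s < t \<and> t < (5::nat)} = {(0, 1, 2), (0, 1, 3), (0, 1, 4)} \<union> R"
  proof -
    have "r < s \<and> s < t \<and> t < 5 \<longleftrightarrow> (r, s, t) \<in> {(0, 1, 2), (0, 1, 3), (0, 1, 4)} \<union> R" for r s t :: nat
      unfolding R_def Un_iff insert_iff prod.inject empty_iff by presburger
    then show ?thesis by blast
  qed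
  have total: "(\<Sum>(r, s, t) \<in> {(r, s, t). r < s \<and> s < t \<and> t < 5}. web_eta form r s t z) =
      (- (x 0 z * (- \<beta> z * inverse (t z))) + g1 z, - \<beta> z * inverse (t z) + g2 z)" if z: "z \<in> U" for z
  proof -
    have zV: "z \<in> V" and t0: "x 0 z - x 1 z \<noteq> 0" using z by (auto simp: U_def t_def)
    have ne': "x i z \<noteq> x j z" if "i < 5" "j < 5" "i \<noteq> j" for i j
      using ne[of i j z] t0 that zV by (cases "{i, j} = {0, 1}") (auto simp: doubleton_eq_iff)
    have eta: "web_eta form r s t z = (eta1 r s t z, eta2 r s t z)"
      if "(r, s, t) \<in> {(r, s, t). r < s \<and> s < t \<and> t < (5::nat)}" for r s t
      using that by (intro web_eta_form zV ne') auto
    have e2: "eta2 0 1 j z = (N 0 1 j z - b j z) / (x 0 z - x j z) -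
        (a 0 z - a 1 z + x j z * (b 0 z - b 1 z)) / (x 0 z - x j z) * inverse (t z)"
      if "1 < j" "j < 5" for j
    proof -
      have N: "N j 0 1 z = (a 0 z - a 1 z + x j z * (b 0 z - b 1 z)) * inverse (t z) + b j z"
      proof -
        have "N j 0 1 z = (a 1 z - a 0 z + x j z * (b 1 z - b 0 z)) / (x 1 z - x 0 z) + b j z"
          by (simp add: N_def)
        also have "(a 1 z - a 0 z + x j z * (b 1 z - b 0 z)) / (x 1 z - x 0 z) =
            (- (a 0 z - a 1 z + x j z * (b 0 z - b 1 z))) / (- (x 0 z - x 1 z))"
          by (simp add: algebra_simps)
        also have "\<dots> = (a 0 z - a 1 z + x j z * (b 0 z - b 1 z)) / (x 0 z - x 1 z)"
          by (rule minus_divide_divide)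
        finally show ?thesis by (simp add: t_def divide_inverse)
      qed
      then show ?thesis
        unfolding eta2_def N by (simp add: divide_inverse algebra_simps)
    qed
    have "(\<Sum>(r, s, t) \<in> {(r, s, t). r < s \<and> s < t \<and> t < 5}. web_eta form r s t z) =
        (\<Sum>(r, s, t) \<in> {(r, s, t). r < s \<and> s < t \<and> t < 5}. (eta1 r s t z, eta2 r s t z))"
      using eta by (intro sum.cong) auto
    also have "\<dots> = (\<Sum>(r, s, t) \<in> {(0, 1, 2), (0, 1, 3), (0, 1, 4)}. (eta1 r s t z, eta2 r s t z)) +
        (\<Sum>(r, s, t) \<in> R. (eta1 r s t z, eta2 r s t z))"
      unfolding triples by (rule sum.union_disjoint) (auto simp: R_def)
    also have "(\<Sum>(r, s, t) \<in> R. (eta1 r s t z, eta2 r s t z)) =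
        (\<Sum>(r, s, t) \<in> R. eta1 r s t z, \<Sum>(r, s, t) \<in> R. eta2 r s t z)"
      by (simp add: prod_eq_iff fst_sum snd_sum case_prod_unfold)
    also have "(\<Sum>(r, s, t) \<in> {(0, 1, 2), (0, 1, 3), (0, 1, 4)}. (eta1 r s t z, eta2 r s t z)) =
        (\<Sum>j\<in>{2,3,4}. eta1 0 1 j z, \<Sum>j\<in>{2,3,4}. eta2 0 1 j z)"
      by simp
    also have "(\<Sum>j\<in>{2,3,4}. eta1 0 1 j z) = (\<Sum>j\<in>{2,3,4}. N 0 1 j z) - x 0 z * (\<Sum>j\<in>{2,3,4}. eta2 0 1 j z)"
      by (simp add: eta1_def algebra_simps)
    also have "(\<Sum>j\<in>{2,3,4}. eta2 0 1 j z) = h2 z - \<beta> z * inverse (t z)"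
      unfolding h2_def \<beta>_def sum_distrib_right sum_subtractf[symmetric]
      by (intro sum.cong refl e2) auto
    finally show ?thesis
      by (simp add: g1_def g2_def algebra_simps)
  qed
  have zero: "\<Psi> z = 0" if z: "z \<in> U" for z
  proof -
    have zV: "z \<in> V" and t0: "t z \<noteq> 0" using z by (auto simp: U_def)
    have it: "has_partials U (\<lambda>z. inverse (t z)) (\<lambda>z. - (a 0 z - a 1 z) / (t z)\<^sup>2) (\<lambda>z. - (b 0 z - b 1 z) / (t z)\<^sup>2)"
      by (intro has_partials_inverse has_partials_subset[OF t UV]) (auto simp: U_def)
    note m = has_partials_mult[OF has_partials_minus[OF has_partials_subset[OF \<beta>(1) UV]] it]
    have "0 = web_curvature 5 form z"
      using flat[OF zV] t0 by (simp add: t_def)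
    also have "\<dots> = ext_d (\<lambda>z. (- (x 0 z * (- \<beta> z * inverse (t z))) + g1 z, - \<beta> z * inverse (t z) + g2 z)) z"
      unfolding web_curvature_def by (rule ext_d_cong_open[OF open_U z total])
    also have "\<dots> = (- \<beta>p z * inverse (t z) + - \<beta> z * (- (a 0 z - a 1 z) / (t z)\<^sup>2) + g2p z) -
       (- (b 0 z * (- \<beta> z * inverse (t z)) + x 0 z * (- \<beta>q z * inverse (t z) + - \<beta> z * (- (b 0 z - b 1 z) / (t z)\<^sup>2))) + g1q z)"
      by (rule ext_d_has_partials[OF has_partials_add[OF has_partials_minus[OF
            has_partials_mult[OF has_partials_subset[OF partials[of 0] UV] m]] has_partials_subset[OF g1(1) UV]]
            has_partials_add[OF m has_partials_subset[OF g2(1) UV]] z]) simp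
    also have "\<dots> = - \<Psi> z / (t z)\<^sup>2"
      using t0 by (simp add: \<Psi>_def field_simps power2_eq_square)
    finally show ?thesis using t0 by simp
  qed
  define \<tau> where "\<tau> = a 0 z0 - a 1 z0 + x 0 z0 * (b 0 z0 - b 1 z0)"
  have tz0: "t z0 = 0" using z0 by (simp add: t_def)
  have "\<tau> * \<beta> z0 = 0"
  proof (rule ccontr)
    \<comment> \<open>\<open>\<tau>\<close> is the derivative of \<open>t\<close> along the
      foliation 0. If the product were nonzero, \<open>\<Psi>\<close> would be nonzero near
      \<open>z0\<close>, which is possible only where \<open>t = 0\<close>; so \<open>t\<close>
      would vanish on an open set and its derivative, hence \<open>\<tau>\<close>, would be
      zero.\<close>
    assume *: "\<tau> * \<beta> z0 \<noteq> 0"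
    have cx: "continuous_on V (x 0)" "continuous_on V (a 0)" "continuous_on V (b 0)" "continuous_on V (a 1)" "continuous_on V (b 1)"
      "continuous_on V \<beta>"
      using C1V C1_beta by (auto intro: C1_continuous_on)
    have "continuous_on V \<Psi>"
      unfolding \<Psi>_def[abs_def] using cx cont_t g1 g2 \<beta>
      by (intro continuous_on_add continuous_on_diff continuous_on_mult continuous_on_power)
    then have "open (V \<inter> \<Psi> -` (- {0}))"
      using continuous_open_preimage[OF _ open_V, of \<Psi> "- {0}"] by auto
    moreover have "z0 \<in> V \<inter> \<Psi> -` (- {0})"
      using * z0 tz0 by (auto simp: \<Psi>_def \<tau>_def)
    moreover have "t w = 0" if "w \<in> V \<inter> \<Psi> -` (- {0})" for w
      using zero[of w] that by (auto simp: U_def)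
    moreover have dt: "(t has_derivative (\<lambda>w. (a 0 z0 - a 1 z0) * fst w + (b 0 z0 - b 1 z0) * snd w)) (at z0)"
      using t z0 by (auto simp: has_partials_def)
    ultimately have "((\<lambda>w. 0) has_derivative (\<lambda>w. (a 0 z0 - a 1 z0) * fst w + (b 0 z0 - b 1 z0) * snd w)) (at z0)"
      by (metis (no_types, lifting) has_derivative_transform_within_open)
    then have "(\<lambda>w. (a 0 z0 - a 1 z0) * fst w + (b 0 z0 - b 1 z0) * snd w) = (\<lambda>w. 0)"
      by (rule has_derivative_unique[OF _ has_derivative_const])
    then have "\<tau> = 0"
      using fun_cong[of _ _ "(1, x 0 z0)"] by (fastforce simp: \<tau>_def mult.commute)
    with * show False by simp
  qed
  then show ?thesis by (simp only: \<tau>_def \<beta>_def)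
qed

section \<open>Holomorphic dependence of simple roots on the coefficients\<close>

text \<open>The value at \<open>r\<close> is the leading coefficient times the product of the
  differences between \<open>r\<close> and the roots; splitting off one root at a time gives the
  bound. Read contrapositively, a small value at \<open>r\<close> forces a root close to
  \<open>r\<close>, which is the continuity of roots used below.\<close>

lemma root_near:
  fixes p :: "complex poly"
  assumes "p \<noteq> 0" "e > 0" and far: "\<And>y. poly p y = 0 \<Longrightarrow> e \<le> dist y r"
  shows "norm (lead_coeff p) * e ^ degree p \<le> norm (poly p r)"
  using assms
proof (induction "degree p" arbitrary: p)
  case 0
  then obtain c where "p = [:c:]" using degree_eq_zeroE by metis
  then show ?case by simp
next
  case (Suc n)
  have "\<not> constant (poly p)" using Suc.hyps(2) by (simp add: constant_degree)
  then obtain y where y: "poly p y = 0" using fundamental_theorem_of_algebra by blast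
  then obtain q where q: "p = [:- y, 1:] * q" using poly_eq_0_iff_dvd by (metis dvdE)
  have q0: "q \<noteq> 0" using q Suc.prems by auto
  have deg: "degree p = Suc (degree q)" unfolding q using q0 by (subst degree_mult_eq) auto
  have "norm (lead_coeff q) * e ^ degree q \<le> norm (poly q r)"
    using Suc.hyps deg q0 Suc.prems by (intro Suc.hyps(1)) (auto simp: q)
  moreover have "e \<le> norm (r - y)" using Suc.prems(3)[OF y] by (simp add: dist_norm norm_minus_commute)
  ultimately have "norm (lead_coeff q) * e ^ degree q * e \<le> norm (poly q r) * norm (r - y)"
    using Suc.prems by (intro mult_mono) auto
  moreover have "lead_coeff p = lead_coeff q" unfolding q lead_coeff_mult by simp
  moreover have "poly p r = (r - y) * poly q r" by (simp add: q algebra_simps)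
  ultimately show ?case unfolding deg by (simp add: norm_mult mult_ac)
qed

lemma continuous_on_poly_coeffs:
  fixes f :: "'a::topological_space \<Rightarrow> complex poly"
  assumes "\<And>z. z \<in> V \<Longrightarrow> degree (f z) \<le> n" "\<And>i. continuous_on V (\<lambda>z. coeff (f z) i)"
    "continuous_on V g"
  shows "continuous_on V (\<lambda>z. poly (f z) (g z))"
proof -
  have "continuous_on V (\<lambda>z. \<Sum>i\<le>n. coeff (f z) i * g z ^ i)"
    by (intro continuous_on_sum continuous_on_mult continuous_on_power assms)
  moreover have "poly (f z) (g z) = (\<Sum>i\<le>n. coeff (f z) i * g z ^ i)" if "z \<in> V" for z
    unfolding poly_altdef using assms(1)[OF that]
    by (intro sum.mono_neutral_left) (auto simp: coeff_eq_0)
  ultimately show ?thesis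
    by (simp cong: continuous_on_cong)
qed

text \<open>Near \<open>z0\<close> each root of \<open>f z0\<close> has exactly one root of \<open>f z\<close> in its ball, because the balls are
  disjoint and there are only \<open>n\<close> roots.\<close>

lemma simple_roots_local:
  fixes f :: "'a::metric_space \<Rightarrow> complex poly"
  assumes V: "open V" "z0 \<in> V"
    and deg: "\<And>z. z \<in> V \<Longrightarrow> degree (f z) = n" "n > 0"
    and cont: "\<And>i. continuous_on V (\<lambda>z. coeff (f z) i)"
    and S: "S = {r. poly (f z0) r = 0}" "card S = n"
  obtains W \<rho> where "open W" "z0 \<in> W" "W \<subseteq> V"
    "\<And>r. r \<in> S \<Longrightarrow> continuous_on W (\<rho> r)" "\<And>r. r \<in> S \<Longrightarrow> \<rho> r z0 = r"
    "\<And>z. z \<in> W \<Longrightarrow> {y. poly (f z) y = 0} = (\<lambda>r. \<rho> r z) ` S"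
    "\<And>z. z \<in> W \<Longrightarrow> inj_on (\<lambda>r. \<rho> r z) S"
proof -
  have f0: "f z \<noteq> 0" if "z \<in> V" for z using deg that by force
  have finS: "finite S" using S poly_roots_finite[OF f0[OF V(2)]] by simp
  have lc: "lead_coeff (f z) = coeff (f z) n" "coeff (f z) n \<noteq> 0" if "z \<in> V" for z
    using deg(1)[OF that] f0[OF that] by auto
  have "\<exists>e>0. \<forall>r\<in>S. \<forall>s\<in>S. r \<noteq> s \<longrightarrow> 2 * e \<le> dist r s"
  proof (cases "\<exists>r\<in>S. \<exists>s\<in>S. r \<noteq> s")
    case True
    define D where "D = (\<lambda>(r, s). dist r s) ` {(r, s) \<in> S \<times> S. r \<noteq> s}"
    have D: "finite D" "D \<noteq> {}"
      using finS True by (auto simp: D_def intro!: finite_imageI intro: finite_subset[of _ "S \<times> S"])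
    then have "Min D \<in> D" by (rule Min_in)
    then have "Min D > 0" by (auto simp: D_def)
    moreover have "Min D \<le> dist r s" if "r \<in> S" "s \<in> S" "r \<noteq> s" for r s
      using D that by (intro Min_le) (auto simp: D_def intro!: rev_image_eqI[of "(r, s)"])
    ultimately show ?thesis by (intro exI[of _ "Min D / 2"]) auto
  qed (auto intro: exI[of _ 1])
  then obtain e where e: "e > 0" "\<And>r s. r \<in> S \<Longrightarrow> s \<in> S \<Longrightarrow> r \<noteq> s \<Longrightarrow> 2 * e \<le> dist r s" by blast
  have opn: "open {z \<in> V. norm (poly (f z) y) < norm (coeff (f z) n) * d ^ n}" for y d
  proof -
    have "continuous_on V (\<lambda>z. norm (coeff (f z) n) * d ^ n - norm (poly (f z) y))"
      using deg by (intro continuous_on_diff continuous_on_mult continuous_on_norm continuous_on_const cont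
        continuous_on_poly_coeffs[of V f n]) auto
    then have "open (V \<inter> (\<lambda>z. norm (coeff (f z) n) * d ^ n - norm (poly (f z) y)) -` {0<..})"
      by (intro continuous_open_preimage V) auto
    then show ?thesis by (rule back_subst[where P = "open"]) auto
  qed
  have near: "\<exists>x. poly (f z) x = 0 \<and> dist x y < d"
    if "z \<in> V" "d > 0" "norm (poly (f z) y) < norm (coeff (f z) n) * d ^ n" for z y d
    using root_near[OF f0[OF that(1)] that(2), of y] that(3) deg(1)[OF that(1)] by force
  define W where "W = (\<Inter>r\<in>S. {z \<in> V. norm (poly (f z) r) < norm (coeff (f z) n) * e ^ n}) \<inter> V"
  have W: "open W" unfolding W_def using finS opn V by (intro open_Int open_INT) auto
  have zW: "z0 \<in> W" using V lc[OF V(2)] e by (auto simp: W_def S)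
  have WV: "W \<subseteq> V" by (auto simp: W_def)
  define \<rho> where "\<rho> r z = (SOME x. poly (f z) x = 0 \<and> dist x r < e)" for r z
  have \<rho>: "poly (f z) (\<rho> r z) = 0" "dist (\<rho> r z) r < e" if "r \<in> S" "z \<in> W" for r z
    using someI_ex[OF near[of z e r]] that e unfolding \<rho>_def by (auto simp: W_def)
  have inj: "inj_on (\<lambda>r. \<rho> r z) S" if "z \<in> W" for z
  proof (rule inj_onI, rule ccontr)
    fix r s assume rs: "r \<in> S" "s \<in> S" "\<rho> r z = \<rho> s z" "r \<noteq> s"
    have "dist r s < 2 * e" using \<rho>(2)[OF rs(1) that] \<rho>(2)[OF rs(2) that] rs(3)
        dist_triangle[of r s "\<rho> r z"] by (simp add: dist_commute)
    with e(2)[OF rs(1,2,4)] show False by simp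
  qed
  have roots: "{y. poly (f z) y = 0} = (\<lambda>r. \<rho> r z) ` S" if z: "z \<in> W" for z
  proof (rule card_seteq[symmetric])
    have zV: "z \<in> V" using z WV by auto
    show "finite {y. poly (f z) y = 0}" by (rule poly_roots_finite[OF f0[OF zV]])
    show "(\<lambda>r. \<rho> r z) ` S \<subseteq> {y. poly (f z) y = 0}" using \<rho> z by auto
    have "card {y. poly (f z) y = 0} \<le> n" using card_poly_roots_bound[OF f0[OF zV]] deg(1)[OF zV] by simp
    then show "card {y. poly (f z) y = 0} \<le> card ((\<lambda>r. \<rho> r z) ` S)"
      using S card_image[OF inj[OF z]] by simp
  qed
  \<comment> \<open>The root in each ball is unique, so the choice made by \<open>SOME\<close> is
    the only possible one; this ties the values at neighbouring points together.\<close>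
  have uniq: "y = \<rho> r z" if y: "r \<in> S" "z \<in> W" "poly (f z) y = 0" "dist y r < e" for r z y
  proof -
    obtain s where s: "s \<in> S" "y = \<rho> s z" using roots[OF y(2)] y(3) by auto
    have "dist r s < 2 * e"
      using \<rho>(2)[OF s(1) y(2)] y(4) dist_triangle[of r s y] by (simp add: s dist_commute)
    then have "r = s" using e(2)[OF y(1) s(1)] by force
    with s show ?thesis by simp
  qed
  have "continuous_on W (\<rho> r)" if r: "r \<in> S" for r
    unfolding continuous_on_iff
  proof (intro ballI allI impI)
    fix z1 d assume z1: "z1 \<in> W" and d: "(0::real) < d"
    \<comment> \<open>The ball of radius \<open>d'\<close> around the root at \<open>z1\<close>
      stays inside the ball of radius \<open>e\<close> around \<open>r\<close>, so the root found in
      the smaller ball must be the chosen one.\<close>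
    define d' where "d' = min d (e - dist (\<rho> r z1) r)"
    have d': "d' > 0" "d' \<le> d" "d' \<le> e - dist (\<rho> r z1) r" using d \<rho>(2)[OF r z1] by (auto simp: d'_def)
    have "z1 \<in> {z \<in> V. norm (poly (f z) (\<rho> r z1)) < norm (coeff (f z) n) * d' ^ n}"
      using \<rho>(1)[OF r z1] lc[of z1] d' z1 WV by auto
    then obtain k where k: "k > 0" "ball z1 k \<subseteq> {z \<in> V. norm (poly (f z) (\<rho> r z1)) < norm (coeff (f z) n) * d' ^ n}"
      using opn open_contains_ball by blast
    show "\<exists>k>0. \<forall>x'\<in>W. dist x' z1 < k \<longrightarrow> dist (\<rho> r x') (\<rho> r z1) < d"
    proof (intro exI conjI ballI impI)
      fix z assume z: "z \<in> W" "dist z z1 < k"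
      then obtain y where y: "poly (f z) y = 0" "dist y (\<rho> r z1) < d'"
        using near[of z d' "\<rho> r z1"] k d' by (auto simp: dist_commute subset_iff)
      have "dist y r < e" using y d' dist_triangle[of y r "\<rho> r z1"] by linarith
      then have "y = \<rho> r z" using uniq r z y by blast
      with y d' show "dist (\<rho> r z) (\<rho> r z1) < d" by simp
    qed (use k in auto)
  qed
  moreover have "\<rho> r z0 = r" if "r \<in> S" for r
    using uniq[OF that zW, of r] that e by (simp add: S)
  ultimately show ?thesis using that W zW WV roots inj by metis
qed

text \<open>In the product rule the derivative of \<open>h\<close> would be multiplied by
  \<open>F a = 0\<close>, so continuity of \<open>h\<close> is enough. It serves to differentiate a
  quotient whose denominator contains a root not yet known to be differentiable.\<close>

lemma has_derivative_mult_vanishing: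
  fixes F h :: "'a::real_normed_vector \<Rightarrow> complex"
  assumes F: "(F has_derivative F') (at a)" "F a = 0" and h: "isCont h a"
  shows "((\<lambda>z. F z * h z) has_derivative (\<lambda>w. F' w * h a)) (at a)"
  unfolding has_derivative_iff_norm
proof
  have bl: "bounded_linear F'" using F by (auto simp: has_derivative_iff_norm)
  then show "bounded_linear (\<lambda>w. F' w * h a)"
    by (rule bounded_linear_compose[OF bounded_linear_mult_left])
  obtain K where K: "\<And>w. norm (F' w) \<le> norm w * K" using bounded_linear.bounded[OF bl] by blast
  have lim: "((\<lambda>y. norm (F y - F a - F' (y - a)) / norm (y - a)) \<longlongrightarrow> 0) (at a)"
    using F by (auto simp: has_derivative_iff_norm)
  have "((\<lambda>y. norm (F y - F a - F' (y - a)) / norm (y - a) * norm (h y) + K * norm (h y - h a)) \<longlongrightarrow>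
      0 * norm (h a) + K * norm (h a - h a)) (at a)"
    using h by (intro tendsto_intros lim) (auto simp: isCont_def)
  then have lim2: "((\<lambda>y. norm (F y - F a - F' (y - a)) / norm (y - a) * norm (h y) + K * norm (h y - h a)) \<longlongrightarrow> 0) (at a)"
    by simp
  show "((\<lambda>y. norm (F y * h y - F a * h a - F' (y - a) * h a) / norm (y - a)) \<longlongrightarrow> 0) (at a)"
  proof (rule Lim_null_comparison[OF _ lim2])
    show "\<forall>\<^sub>F y in at a. norm (norm (F y * h y - F a * h a - F' (y - a) * h a) / norm (y - a))
       \<le> norm (F y - F a - F' (y - a)) / norm (y - a) * norm (h y) + K * norm (h y - h a)"
      unfolding eventually_at_filter
    proof (intro always_eventually allI impI)
      fix y assume y: "y \<noteq> a"
      have "F y * h y - F a * h a - F' (y - a) * h a =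
          (F y - F a - F' (y - a)) * h y + F' (y - a) * (h y - h a)"
        using F(2) by (simp add: algebra_simps)
      then have "norm (F y * h y - F a * h a - F' (y - a) * h a) \<le>
          norm (F y - F a - F' (y - a)) * norm (h y) + norm (F' (y - a)) * norm (h y - h a)"
        by (metis norm_triangle_ineq norm_mult)
      also have "\<dots> \<le> norm (F y - F a - F' (y - a)) * norm (h y) + norm (y - a) * K * norm (h y - h a)"
        using K by (intro add_left_mono mult_right_mono) auto
      finally show "norm (norm (F y * h y - F a * h a - F' (y - a) * h a) / norm (y - a))
         \<le> norm (F y - F a - F' (y - a)) / norm (y - a) * norm (h y) + K * norm (h y - h a)"
        using y by (simp add: divide_simps) (simp add: algebra_simps)
    qed
  qed
qed

text \<open>Implicit differentiation from mere continuity of the root. For fixed \<open>z1\<close>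
  the equation at \<open>z\<close> reads \<open>F z + (\<rho> z - \<rho> z1) * g z = 0\<close>,
  where \<open>F\<close> has the root frozen at \<open>\<rho> z1\<close> and \<open>g\<close> is a
  difference quotient with \<open>g z1 = D z1\<close>. Hence
  \<open>\<rho> z = \<rho> z1 - F z / g z\<close> near \<open>z1\<close>, with
  \<open>F z1 = 0\<close>.\<close>

lemma has_partials_root:
  assumes V: "open V" and c: "\<And>i. i \<le> n \<Longrightarrow> has_partials V (c i) (cp i) (cq i)"
    and cont: "continuous_on V \<rho>"
    and root: "\<And>z. z \<in> V \<Longrightarrow> (\<Sum>i\<le>n. c i z * \<rho> z ^ i) = 0"
    and D: "\<And>z. D z = (\<Sum>i\<le>n. of_nat i * c i z * \<rho> z ^ (i - 1))"
    and simple: "\<And>z. z \<in> V \<Longrightarrow> D z \<noteq> 0"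
  shows "has_partials V \<rho> (\<lambda>z. - (\<Sum>i\<le>n. cp i z * \<rho> z ^ i) / D z) (\<lambda>z. - (\<Sum>i\<le>n. cq i z * \<rho> z ^ i) / D z)"
  unfolding has_partials_def
proof
  fix z1 assume z1: "z1 \<in> V"
  define F where "F z = (\<Sum>i\<le>n. c i z * \<rho> z1 ^ i)" for z
  define g where "g z = (\<Sum>i\<le>n. c i z * (\<Sum>j<i. \<rho> z1 ^ (i - Suc j) * \<rho> z ^ j))" for z
  have eq: "F z + (\<rho> z - \<rho> z1) * g z = 0" if "z \<in> V" for z
  proof -
    have "F z + (\<rho> z - \<rho> z1) * g z = (\<Sum>i\<le>n. c i z * (\<rho> z1 ^ i + (\<rho> z - \<rho> z1) * (\<Sum>j<i. \<rho> z1 ^ (i - Suc j) * \<rho> z ^ j)))"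
      by (simp add: F_def g_def sum_distrib_left sum.distrib algebra_simps)
    also have "\<dots> = (\<Sum>i\<le>n. c i z * \<rho> z ^ i)"
      by (simp flip: power_diff_sumr2)
    finally show ?thesis using root[OF that] by simp
  qed
  have cc: "continuous_on V (c i)" if "i \<le> n" for i using c that has_partials_continuous_on by blast
  have "continuous_on V g"
    unfolding g_def[abs_def] by (intro continuous_on_sum continuous_on_mult continuous_on_power continuous_on_const cont cc) auto
  then have g: "isCont g z1" using V z1 continuous_on_eq_continuous_at by blast
  have g1: "g z1 = D z1"
  proof -
    have "(\<Sum>j<i. \<rho> z1 ^ (i - Suc j) * \<rho> z1 ^ j) = of_nat i * \<rho> z1 ^ (i - 1)" for i
    proof -
      have "(\<Sum>j<i. \<rho> z1 ^ (i - Suc j) * \<rho> z1 ^ j) = (\<Sum>j<i. \<rho> z1 ^ (i - 1))"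
        by (intro sum.cong) (auto simp flip: power_add)
      then show ?thesis by simp
    qed
    then show ?thesis by (simp add: g_def D mult_ac)
  qed
  have "(F has_derivative (\<lambda>w. (\<Sum>i\<le>n. (cp i z1 * fst w + cq i z1 * snd w) * \<rho> z1 ^ i))) (at z1)"
    unfolding F_def[abs_def]
    using c z1 by (intro has_derivative_sum has_derivative_mult_left) (auto simp: has_partials_def)
  then have dF: "(F has_derivative (\<lambda>w. (\<Sum>i\<le>n. cp i z1 * \<rho> z1 ^ i) * fst w + (\<Sum>i\<le>n. cq i z1 * \<rho> z1 ^ i) * snd w)) (at z1)"
    by (rule has_derivative_eq_rhs) (auto simp: sum_distrib_left sum_distrib_right sum.distrib algebra_simps)
  have F1: "F z1 = 0" using eq[OF z1] by simp
  have nz: "g z1 \<noteq> 0" using g1 simple z1 by simp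
  have "((\<lambda>z. F z * (- 1 / g z)) has_derivative (\<lambda>w. ((\<Sum>i\<le>n. cp i z1 * \<rho> z1 ^ i) * fst w + (\<Sum>i\<le>n. cq i z1 * \<rho> z1 ^ i) * snd w) * (- 1 / g z1))) (at z1)"
    by (rule has_derivative_mult_vanishing[OF dF F1]) (intro continuous_intros g nz)
  then have *: "((\<lambda>z. \<rho> z1 + F z * (- 1 / g z)) has_derivative (\<lambda>w. 0 + ((\<Sum>i\<le>n. cp i z1 * \<rho> z1 ^ i) * fst w + (\<Sum>i\<le>n. cq i z1 * \<rho> z1 ^ i) * snd w) * (- 1 / g z1))) (at z1)"
    by (intro has_derivative_add has_derivative_const)
  have "open (V \<inter> g -` (- {0}))"
    using continuous_open_preimage[OF \<open>continuous_on V g\<close> V, of "- {0}"] by auto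
  moreover have "z1 \<in> V \<inter> g -` (- {0})" using nz z1 by auto
  moreover have "\<rho> z1 + F z * (- 1 / g z) = \<rho> z" if "z \<in> V \<inter> g -` (- {0})" for z
  proof -
    have "F z = (\<rho> z1 - \<rho> z) * g z" using eq[of z] that by (simp add: algebra_simps)
    then show ?thesis using that by simp
  qed
  ultimately have "(\<rho> has_derivative (\<lambda>w. 0 + ((\<Sum>i\<le>n. cp i z1 * \<rho> z1 ^ i) * fst w + (\<Sum>i\<le>n. cq i z1 * \<rho> z1 ^ i) * snd w) * (- 1 / g z1))) (at z1)"
    by (rule has_derivative_transform_within_open[OF *])
  then show "(\<rho> has_derivative (\<lambda>w. - (\<Sum>i\<le>n. cp i z1 * \<rho> z1 ^ i) / D z1 * fst w + - (\<Sum>i\<le>n. cq i z1 * \<rho> z1 ^ i) / D z1 * snd w)) (at z1)"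
    by (rule has_derivative_eq_rhs) (auto simp: g1 divide_inverse algebra_simps)
qed

section \<open>The Legendre transform of the Hesse foliation\<close>

definition hA :: "complex \<Rightarrow> complex \<Rightarrow> complex" where
  "hA x y = y * (2 * x ^ 3 - y ^ 3 - 1)"

definition hB :: "complex \<Rightarrow> complex \<Rightarrow> complex" where
  "hB x y = x * (2 * y ^ 3 - x ^ 3 - 1)"

definition hC :: "complex \<Rightarrow> complex \<Rightarrow> complex" where
  "hC x y = x * y * (2 - x ^ 3 - y ^ 3)"

text \<open>Since \<open>A + p B\<close> is expanded at \<open>y = p x - q\<close>, the roots of \<open>hpoly (p, q)\<close> are the
  \<open>x\<close>-coordinates of the tangency points of the line \<open>y = p x - q\<close> with the foliation.\<close>

definition hpoly :: "complex \<times> complex \<Rightarrow> complex poly" where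
  "hpoly = (\<lambda>(p, q). [:q * (1 - q ^ 3), 2 * p * (q ^ 3 - 1), 0, - 2 * q * (p ^ 3 + 1), p * (p ^ 3 + 1):])"

definition hpoly_p :: "complex \<times> complex \<Rightarrow> complex poly" where
  "hpoly_p = (\<lambda>(p, q). [:0, 2 * (q ^ 3 - 1), 0, - 6 * q * p\<^sup>2, 4 * p ^ 3 + 1:])"

definition hpoly_q :: "complex \<times> complex \<Rightarrow> complex poly" where
  "hpoly_q = (\<lambda>(p, q). [:1 - 4 * q ^ 3, 6 * p * q\<^sup>2, 0, - 2 * (p ^ 3 + 1), 0:])"

lemma poly_hpoly: "poly (hpoly (p, q)) x = hA x (p * x - q) + p * hB x (p * x - q)"
  by (simp add: hpoly_def hA_def hB_def) algebra

lemma degree_hpoly: "p \<noteq> 0 \<Longrightarrow> p ^ 3 \<noteq> - 1 \<Longrightarrow> degree (hpoly (p, q)) = 4"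
  by (simp add: hpoly_def add_eq_0_iff2)

lemma has_partials_hpoly:
  assumes "i \<le> 4"
  shows "has_partials V (\<lambda>z. coeff (hpoly z) i) (\<lambda>z. coeff (hpoly_p z) i) (\<lambda>z. coeff (hpoly_q z) i)"
proof -
  have "i = 0 \<or> i = 1 \<or> i = 2 \<or> i = 3 \<or> i = 4" using assms by auto
  then show ?thesis
    unfolding has_partials_def hpoly_def hpoly_p_def hpoly_q_def
    by (elim disjE; simp add: case_prod_unfold coeff_pCons eval_nat_numeral)
      (rule ballI, rule has_derivative_eq_rhs, (rule derivative_intros)+, rule ext, simp add: algebra_simps power2_eq_square)+
qed

lemma C1_hpoly:
  assumes "i \<le> 4" shows "C1 V (\<lambda>z. coeff (hpoly z) i)"
proof -
  have "i = 0 \<or> i = 1 \<or> i = 2 \<or> i = 3 \<or> i = 4" using assms by auto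
  then show ?thesis
    unfolding hpoly_def case_prod_unfold
    by (elim disjE; simp add: eval_nat_numeral) (intro C1_intros)+
qed

lemma C1_hpoly_p:
  assumes "i \<le> 4" shows "C1 V (\<lambda>z. coeff (hpoly_p z) i)"
proof -
  have "i = 0 \<or> i = 1 \<or> i = 2 \<or> i = 3 \<or> i = 4" using assms by auto
  then show ?thesis
    unfolding hpoly_p_def case_prod_unfold
    by (elim disjE; simp add: eval_nat_numeral) (intro C1_intros)+
qed

lemma C1_hpoly_q:
  assumes "i \<le> 4" shows "C1 V (\<lambda>z. coeff (hpoly_q z) i)"
proof -
  have "i = 0 \<or> i = 1 \<or> i = 2 \<or> i = 3 \<or> i = 4" using assms by auto
  then show ?thesis
    unfolding hpoly_q_def case_prod_unfold
    by (elim disjE; simp add: eval_nat_numeral) (intro C1_intros)+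
qed

text \<open>The excluded values of \<open>p\<close> are those for which the point at infinity of
  \<open>y = p x - q\<close> lies on \<open>l\<close> or is a tangency point. Elsewhere no direction
  with \<open>u = 0\<close> belongs to the web, so finite slopes describe it completely.\<close>

lemma Leg_hesse_iff:
  assumes "p \<noteq> 0" "p ^ 3 \<noteq> - 1" "l$1 + l$2 * p \<noteq> 0" "(u, v) \<noteq> (0, 0)"
  shows "Leg l hesse (p, q) (u, v) \<longleftrightarrow>
    (\<exists>x. v = x * u \<and> (x = (l$2 * q - l$3) / (l$1 + l$2 * p) \<or> poly (hpoly (p, q)) x = 0))"
proof (cases "u = 0")
  case True
  then have v: "v \<noteq> 0" using assms by simp
  have "v * (l$1 + l$2 * p) \<noteq> 0" using v assms by simp
  then have "scalar_product l (dual_dir_point (p, q) (0, v)) \<noteq> 0"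
    by (simp add: dual_dir_point_def scalar_product_def sum_3 algebra_simps)
  moreover have "\<not> tangent_at hesse (dual_line (p, q)) (dual_dir_point (p, q) (0, v))"
  proof
    let ?w = "vector [0, - q, 1] :: complex^3"
    assume "tangent_at hesse (dual_line (p, q)) (dual_dir_point (p, q) (0, v))"
    moreover have "scalar_product (dual_line (p, q)) ?w = 0"
      by (simp add: dual_line_def scalar_product_def sum_3)
    ultimately have "scalar_product (hesse (dual_dir_point (p, q) (0, v))) ?w = 0"
      by (simp add: tangent_at_def)
    then have "p * v ^ 5 * (p ^ 3 + 1) = 0"
      by (simp add: hesse_def dual_dir_point_def scalar_product_def sum_3 Let_def) algebra
    with v assms show False by (simp add: add_eq_0_iff2)
  qed
  ultimately show ?thesis
    using True v by (simp add: Leg_def)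
next
  case False
  let ?m = "dual_dir_point (p, q) (1, v / u)"
  have eq: "dual_dir_point (p, q) (u, v) = u *s ?m"
    using False by (simp add: dual_dir_point_def vec_eq_iff forall_3 algebra_simps)
  have sc: "scalar_product (c *s m) w = c * scalar_product m w" "scalar_product m (c *s w) = c * scalar_product m w"
    for c :: complex and m w :: "complex^3"
    by (simp_all add: scalar_product_def sum_3 algebra_simps)
  have "Leg l hesse (p, q) (u, v) \<longleftrightarrow> Leg l hesse (p, q) (1, v / u)"
    using False by (simp add: Leg_def eq tangent_at_def hesse_homogeneous sc)
  also have "\<dots> \<longleftrightarrow> (l$1 * (v / u) + l$2 * (p * (v / u) - q) + l$3) * poly (hpoly (p, q)) (v / u) = 0"
    unfolding Leg_affine[of hesse, OF hesse_euler] poly_hpoly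
    by (simp add: hesse_def Let_def hA_def hB_def)
  also have "\<dots> \<longleftrightarrow> v / u = (l$2 * q - l$3) / (l$1 + l$2 * p) \<or> poly (hpoly (p, q)) (v / u) = 0"
  proof -
    have "l$1 * (v / u) + l$2 * (p * (v / u) - q) + l$3 = (l$1 + l$2 * p) * (v / u) - (l$2 * q - l$3)"
      by (simp add: algebra_simps)
    then show ?thesis
      using nonzero_eq_divide_eq[OF assms(3), of "v / u" "l$2 * q - l$3"]
      by (simp only: mult_eq_0_iff right_minus_eq mult.commute) blast
  qed
  also have "\<dots> \<longleftrightarrow> (\<exists>x. v = x * u \<and> (x = (l$2 * q - l$3) / (l$1 + l$2 * p) \<or> poly (hpoly (p, q)) x = 0))"
  proof -
    have "v = x * u \<longleftrightarrow> x = v / u" for x using False by (auto simp: eq_divide_eq)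
    then show ?thesis by simp
  qed
  finally show ?thesis .
qed

text \<open>Write the quartic as \<open>P = (X - r) Q\<close>. Then \<open>P' (r) = Q (r)\<close>
  and \<open>P'' (r) = 2 Q' (r)\<close>, and the sum is the logarithmic derivative of
  \<open>Q\<close> at \<open>r\<close>.\<close>

lemma sum_inverse_root_differences:
  fixes r :: complex
  assumes p: "[:c0, c1, c2, c3, c4:] = smult c4 ([:- r, 1:] * [:- r2, 1:] * [:- r3, 1:] * [:- r4, 1:])"
    and "r \<noteq> r2" "r \<noteq> r3" "r \<noteq> r4"
  shows "(1 / (r - r2) + 1 / (r - r3) + 1 / (r - r4)) * (c1 + 2 * c2 * r + 3 * c3 * r ^ 2 + 4 * c4 * r ^ 3) * 2 =
    2 * c2 + 6 * c3 * r + 12 * c4 * r ^ 2"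
proof -
  have c: "c1 = - c4 * (r * r2 * r3 + r * r2 * r4 + r * r3 * r4 + r2 * r3 * r4)"
    "c2 = c4 * (r * r2 + r * r3 + r * r4 + r2 * r3 + r2 * r4 + r3 * r4)" "c3 = - c4 * (r + r2 + r3 + r4)"
    using p by (simp_all add: algebra_simps)
  have 1: "c1 + 2 * c2 * r + 3 * c3 * r ^ 2 + 4 * c4 * r ^ 3 = c4 * ((r - r2) * (r - r3) * (r - r4))"
    unfolding c by algebra
  have 2: "(1 / (r - r2) + 1 / (r - r3) + 1 / (r - r4)) * ((r - r2) * (r - r3) * (r - r4)) =
      (r - r3) * (r - r4) + (r - r2) * (r - r4) + (r - r2) * (r - r3)"
  proof -
    have "(1 / u + 1 / v + 1 / w) * (u * v * w) = v * w + u * w + u * v"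
      if "u \<noteq> 0" "v \<noteq> 0" "w \<noteq> 0" for u v w :: complex
      using that by (simp add: field_simps)
    then show ?thesis using assms by simp
  qed
  have "(1 / (r - r2) + 1 / (r - r3) + 1 / (r - r4)) * (c1 + 2 * c2 * r + 3 * c3 * r ^ 2 + 4 * c4 * r ^ 3) * 2 =
      2 * c4 * ((1 / (r - r2) + 1 / (r - r3) + 1 / (r - r4)) * ((r - r2) * (r - r3) * (r - r4)))"
    unfolding 1 by (simp add: mult_ac)
  also have "\<dots> = 2 * c2 + 6 * c3 * r + 12 * c4 * r ^ 2"
    unfolding 2 c by algebra
  finally show ?thesis .
qed

text \<open>At a point where the slope of \<open>Leg l\<close> equals a root \<open>r\<close>, the first factor of the residue condition
  is \<open>B / P\<^sub>x\<close>, which does not vanish, and the sum over the remaining roots is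
  \<open>P\<^sub>x\<^sub>x / (2 P\<^sub>x)\<close>. Here \<open>hpoly_p\<close>, \<open>hpoly_q\<close> are the partial derivatives of \<open>hpoly\<close>.\<close>

lemma flat_at_simple_tangency:
  assumes flat: "flat_web 5 (Leg l hesse)"
    and pq: "p \<noteq> 0" "p ^ 3 \<noteq> - 1" "l$1 + l$2 * p \<noteq> 0"
    and r: "r = (l$2 * q - l$3) / (l$1 + l$2 * p)" "poly (hpoly (p, q)) r = 0"
    and simple: "\<And>x. poly (hpoly (p, q)) x = 0 \<Longrightarrow> poly (pderiv (hpoly (p, q))) x \<noteq> 0"
    and B: "poly (hpoly_p (p, q)) r + r * poly (hpoly_q (p, q)) r \<noteq> 0"
  shows "(poly (hpoly_p (p, q)) r + r * poly (hpoly_q (p, q)) r) * poly (pderiv (pderiv (hpoly (p, q)))) r * (l$1 + l$2 * p) =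
    6 * poly (pderiv (hpoly (p, q))) r *
      (l$2 * poly (pderiv (hpoly (p, q))) r + (l$1 + l$2 * p) * poly (hpoly_q (p, q)) r)"
proof -
  define z0 where "z0 = (p, q)"
  define V0 where "V0 = {z :: complex \<times> complex. fst z \<noteq> 0 \<and> fst z ^ 3 \<noteq> - 1 \<and> l$1 + l$2 * fst z \<noteq> 0}"
  have openV0: "open V0"
    unfolding V0_def by (intro open_Collect_conj open_Collect_neq continuous_intros)
  have z0: "z0 \<in> V0" using pq by (simp add: V0_def z0_def)
  define c where "c i z = coeff (hpoly z) i" for i z
  have deg: "degree (hpoly z) = 4" if "z \<in> V0" for z
    using that degree_hpoly[of "fst z" "snd z"] by (simp add: V0_def)
  have cont_c: "continuous_on V (c i)" for i and V
  proof (cases "i \<le> 4")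
    case True
    then show ?thesis unfolding c_def[abs_def] by (intro C1_continuous_on C1_hpoly)
  next
    case False
    have "c i = (\<lambda>z. 0)"
    proof
      fix z :: "complex \<times> complex"
      have "degree (hpoly z) \<le> 4" by (cases z) (simp add: hpoly_def degree_pCons_eq_if)
      then show "c i z = 0" using False by (simp add: c_def coeff_eq_0)
    qed
    then show ?thesis by simp
  qed
  define S where "S = {x. poly (hpoly z0) x = 0}"
  have sqf: "rsquarefree (hpoly z0)"
    unfolding rsquarefree_roots using simple by (auto simp: z0_def)
  have nz0: "hpoly z0 \<noteq> 0" using deg[OF z0] by force
  have decomp: "smult (lead_coeff (hpoly z0)) (\<Prod>x\<in>S. [:- x, 1:]) = hpoly z0"
    using complex_poly_decompose_rsquarefree[OF sqf] by (simp add: S_def)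
  have finS: "finite S" unfolding S_def by (rule poly_roots_finite[OF nz0])
  have "degree (\<Prod>x\<in>S. [:- x, 1:]) = 4"
    using deg[OF z0] nz0 by (subst (asm) decomp[symmetric]) auto
  moreover have "degree (\<Prod>x\<in>S. [:- x, 1:]) = (\<Sum>x\<in>S. degree [:- x, 1:])"
    by (intro degree_prod_eq_sum_degree) auto
  ultimately have cardS: "card S = 4" by simp
  have "r \<in> S" using r by (simp add: S_def z0_def)
  then have "card (S - {r}) = 3" using cardS finS by simp
  then obtain r2 r3 r4 where rs: "S - {r} = {r2, r3, r4}" "r2 \<noteq> r3" "r3 \<noteq> r4" "r2 \<noteq> r4"
    unfolding card_3_iff by auto
  then have S: "S = {r, r2, r3, r4}" and ne: "r \<noteq> r2" "r \<noteq> r3" "r \<noteq> r4"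
    using \<open>r \<in> S\<close> by auto
  obtain W \<rho> where W: "open W" "z0 \<in> W" "W \<subseteq> V0"
    and \<rho>: "\<And>s. s \<in> S \<Longrightarrow> continuous_on W (\<rho> s)" "\<And>s. s \<in> S \<Longrightarrow> \<rho> s z0 = s"
      "\<And>z. z \<in> W \<Longrightarrow> {y. poly (hpoly z) y = 0} = (\<lambda>s. \<rho> s z) ` S"
      "\<And>z. z \<in> W \<Longrightarrow> inj_on (\<lambda>s. \<rho> s z) S"
    by (rule simple_roots_local[OF openV0 z0 deg _ cont_c[unfolded c_def] S_def cardS]) auto
  define D where "D s z = (\<Sum>i\<le>4. of_nat i * c i z * \<rho> s z ^ (i - 1))" for s z
  define x0 where "x0 z = (l$2 * snd z - l$3) / (l$1 + l$2 * fst z)" for z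
  \<comment> \<open>Shrinking keeps the roots simple and prevents the pencil from meeting any branch
    other than the one through \<open>r\<close>; only a coincidence of the foliations 0 and 1
    remains possible.\<close>
  define V where "V = {z \<in> W. (\<forall>s\<in>S. D s z \<noteq> 0) \<and> (\<forall>s\<in>S - {r}. x0 z \<noteq> \<rho> s z)}"
  have cont_D: "continuous_on W (D s)" if "s \<in> S" for s
    unfolding D_def[abs_def] using that
    by (intro continuous_on_sum continuous_on_mult continuous_on_power continuous_on_const cont_c \<rho>)
  have C1_x0: "C1 W x0"
    unfolding x0_def[abs_def] using W(3)
    by (intro C1_intros) (auto simp: V0_def)
  have VW: "V \<subseteq> W" by (auto simp: V_def)
  have openV: "open V"
  proof -
    have "open (W \<inter> D s -` (- {0}))" if "s \<in> S" for s
      using continuous_open_preimage[OF cont_D[OF that] W(1), of "- {0}"] by auto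
    moreover have "open (W \<inter> (\<lambda>z. x0 z - \<rho> s z) -` (- {0}))" if "s \<in> S" for s
      using that by (intro continuous_open_preimage W continuous_on_diff C1_continuous_on[OF C1_x0] \<rho>) auto
    ultimately have "open (W \<inter> (\<Inter>s\<in>S. W \<inter> D s -` (- {0})) \<inter> (\<Inter>s\<in>S - {r}. W \<inter> (\<lambda>z. x0 z - \<rho> s z) -` (- {0})))"
      using finS by (intro open_Int open_INT W) auto
    then show ?thesis by (rule back_subst[where P = "open"]) (auto simp: V_def)
  qed
  have c_z0: "(\<Sum>i\<le>4. of_nat i * c i z0 * s ^ (i - 1)) = poly (pderiv (hpoly z0)) s" for s
    by (simp add: c_def hpoly_def z0_def pderiv_pCons eval_nat_numeral algebra_simps)
  have D_z0: "D s z0 = poly (pderiv (hpoly z0)) s" if "s \<in> S" for s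
    using c_z0[of s] \<rho>(2)[OF that] by (simp add: D_def)
  have "D s z0 \<noteq> 0" if "s \<in> S" for s
    using D_z0[OF that] that simple by (simp add: S_def z0_def)
  moreover have "x0 z0 \<noteq> \<rho> s z0" if "s \<in> S - {r}" for s
    using \<rho>(2)[of s] that r by (auto simp: x0_def z0_def)
  ultimately have z0V: "z0 \<in> V"
    using W by (simp add: V_def)
  define cp where "cp i z = coeff (hpoly_p z) i" for i z
  define cq where "cq i z = coeff (hpoly_q z) i" for i z
  define \<rho>p where "\<rho>p s z = - (\<Sum>i\<le>4. cp i z * \<rho> s z ^ i) / D s z" for s z
  define \<rho>q where "\<rho>q s z = - (\<Sum>i\<le>4. cq i z * \<rho> s z ^ i) / D s z" for s z
  have poly_c: "poly (hpoly z) y = (\<Sum>i\<le>4. c i z * y ^ i)" if "z \<in> V" for z y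
  proof -
    have "degree (hpoly z) = 4" using deg that VW W(3) by blast
    then show ?thesis by (simp add: poly_altdef c_def)
  qed
  have \<rho>_root: "poly (hpoly z) (\<rho> s z) = 0" if "s \<in> S" "z \<in> V" for s z
    using \<rho>(3)[of z] that VW by blast
  have part_\<rho>: "has_partials V (\<rho> s) (\<rho>p s) (\<rho>q s)" if s: "s \<in> S" for s
    unfolding \<rho>p_def[abs_def] \<rho>q_def[abs_def]
  proof (rule has_partials_root[OF openV])
    show "has_partials V (c i) (cp i) (cq i)" if "i \<le> 4" for i
      unfolding c_def[abs_def] cp_def[abs_def] cq_def[abs_def] using that by (rule has_partials_hpoly)
    show "continuous_on V (\<rho> s)" using \<rho>(1)[OF s] VW continuous_on_subset by blast
    show "(\<Sum>i\<le>4. c i z * \<rho> s z ^ i) = 0" if "z \<in> V" for z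
      using \<rho>_root[OF s that] poly_c[OF that] by simp
    show "D s z = (\<Sum>i\<le>4. of_nat i * c i z * \<rho> s z ^ (i - 1))" for z by (simp add: D_def)
    show "D s z \<noteq> 0" if "z \<in> V" for z using that s by (simp add: V_def)
  qed
  have C1c: "C1 V (c i)" "C1 V (cp i)" "C1 V (cq i)" if "i \<le> 4" for i
    unfolding c_def[abs_def] cp_def[abs_def] cq_def[abs_def]
    using that by (auto intro: C1_hpoly C1_hpoly_p C1_hpoly_q)
  have C1_\<rho>: "C1 V (\<rho> s)" if s: "s \<in> S" for s
  proof (rule C1I[OF part_\<rho>[OF s]])
    have "continuous_on V (\<rho> s)" "continuous_on V (D s)"
      using \<rho>(1)[OF s] cont_D[OF s] VW continuous_on_subset by blast+
    then show "continuous_on V (\<rho>p s)" "continuous_on V (\<rho>q s)"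
      unfolding \<rho>p_def[abs_def] \<rho>q_def[abs_def] using s
      by (intro continuous_on_divide continuous_on_minus continuous_on_sum continuous_on_mult
          continuous_on_power C1_continuous_on[OF C1c(2)] C1_continuous_on[OF C1c(3)]; simp add: V_def)+
  qed
  have C1_D: "C1 V (D s)" if s: "s \<in> S" for s
    unfolding D_def[abs_def] using s by (intro C1_sum C1_mult C1_const C1_power C1c C1_\<rho>) auto
  have C1_\<rho>pq: "C1 V (\<rho>p s)" "C1 V (\<rho>q s)" if s: "s \<in> S" for s
    unfolding \<rho>p_def[abs_def] \<rho>q_def[abs_def] using s
    by (intro C1_divide C1_minus C1_sum C1_mult C1_power C1c C1_\<rho> C1_D; simp add: V_def)+
  \<comment> \<open>Index 0 is the pencil and index 1 the branch it touches, as
    \<open>curvature_residue\<close> requires; the branches occupy the indices from 1 on, whence the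
    shift \<open>i - 1\<close>.\<close>
  define x where "x i = (if i = 0 then x0 else \<rho> ([r, r2, r3, r4] ! (i - 1)))" for i :: nat
  define a where "a i = (if i = 0 then \<lambda>z. - l$2 * x0 z / (l$1 + l$2 * fst z) else \<rho>p ([r, r2, r3, r4] ! (i - 1)))" for i :: nat
  define b where "b i = (if i = 0 then \<lambda>z. l$2 / (l$1 + l$2 * fst z) else \<rho>q ([r, r2, r3, r4] ! (i - 1)))" for i :: nat
  have rS: "[r, r2, r3, r4] ! (i - 1) \<in> S" if "i < 5" "i \<noteq> 0" for i
  proof -
    have "i = 1 \<or> i = 2 \<or> i = 3 \<or> i = 4" using that by auto
    then show ?thesis by (auto simp: S)
  qed
  have nzV: "l$1 + l$2 * fst z \<noteq> 0" if "z \<in> V" for z using that VW W(3) by (auto simp: V0_def)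
  have part_x0: "has_partials V x0 (\<lambda>z. - l$2 * x0 z / (l$1 + l$2 * fst z)) (\<lambda>z. l$2 / (l$1 + l$2 * fst z))"
    unfolding has_partials_def
  proof
    fix z assume z: "z \<in> V"
    show "(x0 has_derivative (\<lambda>w. - l$2 * x0 z / (l$1 + l$2 * fst z) * fst w + l$2 / (l$1 + l$2 * fst z) * snd w)) (at z)"
      unfolding x0_def[abs_def]
      by (rule has_derivative_eq_rhs, (rule derivative_intros)+)
        (use nzV[OF z] in \<open>auto simp: fun_eq_iff field_simps power2_eq_square\<close>)
  qed
  interpret slopes V x a b
  proof
    show "open V" by (rule openV)
    fix i :: nat assume i: "i < 5"
    show "has_partials V (x i) (a i) (b i)"
      using i part_x0 part_\<rho>[OF rS] by (simp add: x_def a_def b_def)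
    show "C1 V (a i)" "C1 V (b i)"
      using i C1_\<rho>pq[OF rS] C1_subset[OF C1_x0 VW] nzV
      by (auto simp: a_def b_def intro!: C1_intros)
  qed
  have ex5: "(\<exists>i<5. P i) \<longleftrightarrow> P 0 \<or> P 1 \<or> P 2 \<or> P 3 \<or> P 4" for P :: "nat \<Rightarrow> bool"
    by (auto simp: eval_nat_numeral less_Suc_eq)
  have x_vals: "x 0 = x0" "x 1 = \<rho> r" "x 2 = \<rho> r2" "x 3 = \<rho> r3" "x 4 = \<rho> r4"
    by (simp_all add: x_def)
  have trans: "x i z \<noteq> x j z" if "i < j" "j < 5" "(i, j) \<noteq> (0, 1)" "z \<in> V" for i j z
  proof -
    have "\<rho> s z \<noteq> \<rho> s' z" if "s \<in> S" "s' \<in> S" "s \<noteq> s'" for s s'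
      using inj_onD[OF \<rho>(4)[of z]] that \<open>z \<in> V\<close> VW by blast
    moreover have "x0 z \<noteq> \<rho> s z" if "s \<in> S" "s \<noteq> r" for s using that \<open>z \<in> V\<close> by (simp add: V_def)
    moreover have "i = 0 \<and> j = 2 \<or> i = 0 \<and> j = 3 \<or> i = 0 \<and> j = 4 \<or> i = 1 \<and> j = 2 \<or> i = 1 \<and> j = 3 \<or>
        i = 1 \<and> j = 4 \<or> i = 2 \<and> j = 3 \<or> i = 2 \<and> j = 4 \<or> i = 3 \<and> j = 4"
      using that(1-3) unfolding prod.inject by presburger
    ultimately show ?thesis
      using ne rs by (elim disjE conjE; simp add: x_vals x_vals(2)[unfolded One_nat_def] S)
  qed
  define U where "U = {z \<in> V. x 0 z \<noteq> x 1 z}"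
  have UV: "U \<subseteq> V" by (auto simp: U_def)
  have openU: "open U"
  proof -
    have "open (V \<inter> (\<lambda>z. x 0 z - x 1 z) -` (- {0}))"
      by (intro continuous_open_preimage openV continuous_on_diff C1_continuous_on C1_x) auto
    then show ?thesis by (rule back_subst[where P = "open"]) (auto simp: U_def)
  qed
  have decomposition: "web_decomposition 5 (Leg l hesse) U form"
    unfolding web_decomposition_def
  proof (intro conjI ballI allI impI)
    show "open U" by (rule openU)
    show "holomorphic2_on (\<lambda>z. fst (form i z)) U" if "i < 5" for i
      unfolding holomorphic2_on_def
    proof
      fix z assume "z \<in> U"
      then have "((\<lambda>z. - x i z) has_derivative (\<lambda>w. - a i z * fst w + - b i z * snd w)) (at z)"
        using has_partials_minus[OF partials[OF that]] UV by (auto simp: has_partials_def)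
      then show "\<exists>a b. ((\<lambda>z. fst (form i z)) has_derivative (\<lambda>(h, k). a * h + b * k)) (at z)"
        unfolding form_def fst_conv case_prod_unfold by blast
    qed
    show "holomorphic2_on (\<lambda>z. snd (form i z)) U" for i
      unfolding holomorphic2_on_def
      by (auto simp: form_def case_prod_unfold intro!: exI[of _ 0])
    show "web_delta form i j z \<noteq> 0" if z: "z \<in> U" and ij: "i < 5" "j < 5" "i \<noteq> j" for z i j
    proof -
      have zV: "z \<in> V" and z01: "x 0 z \<noteq> x 1 z" using z by (auto simp: U_def)
      have *: "x i z \<noteq> x j z" if "i < j" "j < 5" for i j
        using trans[OF that _ zV] z01 by (cases "(i, j) = (0, 1)") auto
      have "x i z \<noteq> x j z"
        using *[of i j] *[of j i] ij by (cases "i < j") auto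
      then show ?thesis by (simp add: web_delta_def wedge_def form_def)
    qed
    fix z w :: "complex \<times> complex" assume z: "z \<in> U" and w: "w \<noteq> (0, 0)"
    have zV: "z \<in> V" using z UV by auto
    have "fst z \<noteq> 0" "fst z ^ 3 \<noteq> - 1" "l$1 + l$2 * fst z \<noteq> 0"
      using zV VW W(3) by (auto simp: V0_def)
    then have "Leg l hesse z w \<longleftrightarrow> (\<exists>y. snd w = y * fst w \<and> (y = x0 z \<or> poly (hpoly z) y = 0))"
      using Leg_hesse_iff[of "fst z" l "fst w" "snd w" "snd z"] w by (simp add: x0_def prod_eq_iff)
    also have "\<dots> \<longleftrightarrow> (\<exists>y. snd w = y * fst w \<and> (y = x0 z \<or> y \<in> (\<lambda>s. \<rho> s z) ` S))"
      using \<rho>(3)[of z] zV VW by blast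
    also have "\<dots> \<longleftrightarrow> (\<exists>i<5. snd w = x i z * fst w)"
      unfolding ex5 x_vals S by auto
    also have "\<dots> \<longleftrightarrow> (\<exists>i<5. form_apply (form i z) w = 0)"
      by (simp add: form_apply_def form_def)
    finally show "Leg l hesse z w \<longleftrightarrow> (\<exists>i<5. form_apply (form i z) w = 0)" .
  qed
  have x01: "x 0 z0 = r" "x 1 z0 = r" "x 2 z0 = r2" "x 3 z0 = r3" "x 4 z0 = r4"
    unfolding x_vals using r \<rho>(2) S by (simp_all add: x0_def z0_def)
  have res: "(a 0 z0 - a 1 z0 + x 0 z0 * (b 0 z0 - b 1 z0)) *
    (\<Sum>j\<in>{2,3,4}. (a 0 z0 - a 1 z0 + x j z0 * (b 0 z0 - b 1 z0)) / (x 0 z0 - x j z0)) = 0"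
  proof (rule curvature_residue[OF trans z0V])
    show "x 0 z0 = x 1 z0" using x01 by simp
    show "web_curvature 5 form z = 0" if "z \<in> V" "x 0 z \<noteq> x 1 z" for z
      using flat decomposition that unfolding flat_web_def by (auto simp: U_def)
  qed
  define Px Pxx Pp Pq where "Px = poly (pderiv (hpoly z0)) r" and "Pxx = poly (pderiv (pderiv (hpoly z0))) r"
    and "Pp = poly (hpoly_p z0) r" and "Pq = poly (hpoly_q z0) r"
  define k where "k = l$1 + l$2 * p"
  have nz: "Px \<noteq> 0" "k \<noteq> 0" "Pp + r * Pq \<noteq> 0"
    using simple[of r] r pq B by (auto simp: Px_def Pp_def Pq_def z0_def k_def)
  have "\<rho>p r z0 = - Pp / Px" "\<rho>q r z0 = - Pq / Px"
    using \<rho>(2)[OF \<open>r \<in> S\<close>] D_z0[OF \<open>r \<in> S\<close>]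
    by (simp_all add: \<rho>p_def \<rho>q_def Pp_def Pq_def Px_def cp_def cq_def hpoly_p_def hpoly_q_def z0_def
        eval_nat_numeral algebra_simps)
  then have ab: "a 0 z0 = - l$2 * r / k" "b 0 z0 = l$2 / k" "a 1 z0 = - Pp / Px" "b 1 z0 = - Pq / Px"
    using x01 by (simp_all add: a_def b_def x_vals k_def z0_def)
  \<comment> \<open>The leaves of the pencil are straight lines, so its slope is constant along them
    and \<open>a 0 + r * b 0 = 0\<close> at \<open>z0\<close>; only the branch contributes to
    \<open>\<tau>\<close>. \<open>\<sigma>\<close> is the value of \<open>b 0 - b 1\<close>.\<close>
  define \<tau> where "\<tau> = (Pp + r * Pq) / Px"
  define \<sigma> where "\<sigma> = l$2 / k + Pq / Px"
  have \<tau>: "a 0 z0 - a 1 z0 + y * (b 0 z0 - b 1 z0) = \<tau> + (y - r) * \<sigma>" for y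
    unfolding ab \<tau>_def \<sigma>_def using nz by (simp add: field_simps)
  have \<tau>j: "(\<tau> + (y - r) * \<sigma>) / (r - y) = \<tau> * (1 / (r - y)) - \<sigma>" if "r \<noteq> y" for y
    using that by (simp add: field_simps)
  have "\<tau> * (\<tau> * (1 / (r - r2) + 1 / (r - r3) + 1 / (r - r4)) - 3 * \<sigma>) = 0"
  proof -
    have "(\<Sum>j\<in>{2,3,4}. (\<tau> + (x j z0 - r) * \<sigma>) / (r - x j z0)) =
        (\<tau> + (r2 - r) * \<sigma>) / (r - r2) + ((\<tau> + (r3 - r) * \<sigma>) / (r - r3) + (\<tau> + (r4 - r) * \<sigma>) / (r - r4))"
      by (simp add: x01)
    also have "\<dots> = \<tau> * (1 / (r - r2) + 1 / (r - r3) + 1 / (r - r4)) - 3 * \<sigma>"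
      unfolding \<tau>j[OF ne(1)] \<tau>j[OF ne(2)] \<tau>j[OF ne(3)] by (simp add: algebra_simps)
    finally show ?thesis using res[unfolded \<tau> x01] by simp
  qed
  then have 1: "\<tau> * (1 / (r - r2) + 1 / (r - r3) + 1 / (r - r4)) = 3 * \<sigma>"
    using nz by (simp add: \<tau>_def)
  have 2: "(1 / (r - r2) + 1 / (r - r3) + 1 / (r - r4)) * Px * 2 = Pxx"
  proof -
    have "[:c 0 z0, c 1 z0, c 2 z0, c 3 z0, c 4 z0:] =
        smult (c 4 z0) ([:- r, 1:] * [:- r2, 1:] * [:- r3, 1:] * [:- r4, 1:])"
    proof -
      have "hpoly z0 = smult (c 4 z0) ([:- r, 1:] * [:- r2, 1:] * [:- r3, 1:] * [:- r4, 1:])"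
        using decomp deg[OF z0] rs ne by (simp add: S c_def mult.assoc del: mult_pCons_left mult_pCons_right)
      moreover have "hpoly z0 = [:c 0 z0, c 1 z0, c 2 z0, c 3 z0, c 4 z0:]"
        by (simp add: c_def hpoly_def z0_def eval_nat_numeral)
      ultimately show ?thesis by simp
    qed
    from sum_inverse_root_differences[OF this ne] show ?thesis
      by (simp add: Px_def Pxx_def c_def hpoly_def z0_def eval_nat_numeral pderiv_pCons algebra_simps)
  qed
  have "(Pp + r * Pq) * Pxx * k = \<tau> * Px * ((1 / (r - r2) + 1 / (r - r3) + 1 / (r - r4)) * Px * 2) * k"
    unfolding 2 using nz by (simp add: \<tau>_def)
  also have "\<dots> = (\<tau> * (1 / (r - r2) + 1 / (r - r3) + 1 / (r - r4))) * Px * Px * 2 * k"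
    by (simp only: mult_ac)
  also have "\<dots> = 6 * Px * (l$2 * Px + k * Pq)"
    unfolding 1 using nz by (simp add: \<sigma>_def field_simps)
  finally show ?thesis by (simp add: Px_def Pxx_def Pp_def Pq_def k_def z0_def)
qed

section \<open>Contact of tangent lines with the foliation, and the resulting equation in the
  point\<close>

lemma poly_pderiv_hpoly:
  "poly (pderiv (hpoly (p, q))) x =
    6 * x\<^sup>2 * (p * x - q) - 2 * p * (x ^ 3 + (p * x - q) ^ 3 + 1) + 6 * p\<^sup>2 * x * (p * x - q)\<^sup>2"
  by (simp add: hpoly_def pderiv_pCons) algebra

lemma poly_pderiv2_hpoly:
  "poly (pderiv (pderiv (hpoly (p, q)))) x = 12 * x * (p * x - q) * (1 + p ^ 3)"
  by (simp add: hpoly_def pderiv_pCons) algebra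

lemma poly_hpoly_q:
  "poly (hpoly_q (p, q)) x = - (2 * x ^ 3 - 4 * (p * x - q) ^ 3 - 1) - 6 * p * x * (p * x - q)\<^sup>2"
  by (simp add: hpoly_q_def) algebra

text \<open>Moving \<open>(p, q)\<close> along the line dual to \<open>(x, y)\<close>, that is with
  \<open>dq = x dp\<close>, keeps \<open>y = p x - q\<close> fixed, so only the explicit
  \<open>p\<close> in \<open>A + p B\<close> is differentiated.\<close>

lemma poly_hpoly_p:
  "poly (hpoly_p (p, q)) x + x * poly (hpoly_q (p, q)) x = hB x (p * x - q)"
  by (simp add: hpoly_p_def hpoly_q_def hB_def) algebra

text \<open>In the chart \<open>z = 1\<close> this is the product of the nine invariant lines other
  than the coordinate lines: it factors into \<open>x ^ 3 + y ^ 3 + 1 - 3 w x y\<close> over the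
  cube roots \<open>w\<close> of unity, the triangles of the Hesse pencil.\<close>

definition hN :: "complex \<Rightarrow> complex \<Rightarrow> complex" where
  "hN x y = (x ^ 3 + y ^ 3 + 1) ^ 3 - 27 * x ^ 3 * y ^ 3"

text \<open>For \<open>p = - A / B\<close> it rewrites \<open>B ^ 3 * (1 + p ^ 3)\<close>, whose
  last factor comes from the second derivative of the quartic, as a multiple of \<open>hN\<close>;
  this allows the cancellation in the flatness equation.\<close>

lemma hA3_minus_hB3: "hA x y ^ 3 - hB x y ^ 3 = (x ^ 3 - y ^ 3) * hN x y"
  unfolding hA_def hB_def hN_def by algebra

text \<open>A double root means contact of higher order with the tangent line, so the inflection
  polynomial has to appear; the factor \<open>B ^ 2\<close> lets every \<open>p\<close> be absorbed
  through \<open>p B = - A\<close>.\<close>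

lemma pderiv_hpoly_tangent:
  assumes "hA x y + p * hB x y = 0" "y = p * x - q"
  shows "(hB x y)\<^sup>2 * poly (pderiv (hpoly (p, q))) x = 2 * x * y * hN x y"
proof -
  have pB: "p * hB x y = - hA x y" using assms(1) by (simp add: eq_neg_iff_add_eq_0 add.commute)
  have "(hB x y)\<^sup>2 * poly (pderiv (hpoly (p, q))) x =
      6 * x\<^sup>2 * y * (hB x y)\<^sup>2 - 2 * (p * hB x y) * hB x y * (x ^ 3 + y ^ 3 + 1) + 6 * (p * hB x y)\<^sup>2 * x * y\<^sup>2"
    unfolding poly_pderiv_hpoly assms(2)[symmetric] by algebra
  also have "\<dots> = 2 * x * y * hN x y"
    unfolding pB unfolding hA_def hB_def hN_def by algebra
  finally show ?thesis .
qed

text \<open>The hypotheses keep the line away from \<open>(1 : 0 : 0)\<close> and from the nine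
  points such as \<open>(1 : - w : 0)\<close> with \<open>w ^ 3 = 1\<close>. A double root would lie
  on \<open>x y hN = 0\<close>. On \<open>hN = 0\<close> one has \<open>A ^ 3 = B ^ 3\<close>, so
  \<open>p ^ 3 \<noteq> - 1\<close> forces a singularity, and there the directions of higher contact
  satisfy \<open>p ^ 3 = - 1\<close>.\<close>

lemma hpoly_roots_simple:
  assumes p: "p \<noteq> 0" "p ^ 3 \<noteq> - 1" and q: "q ^ 3 \<noteq> 1" and pq: "p ^ 3 + q ^ 3 \<noteq> 0"
    and root: "poly (hpoly (p, q)) x = 0"
  shows "poly (pderiv (hpoly (p, q))) x \<noteq> 0"
proof
  assume d: "poly (pderiv (hpoly (p, q))) x = 0"
  define y where "y = p * x - q"
  have t: "hA x y + p * hB x y = 0" using root by (simp add: poly_hpoly y_def)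
  then have pB: "hA x y = - p * hB x y" by (simp add: eq_neg_iff_add_eq_0)
  have "2 * x * y * hN x y = 0"
    using pderiv_hpoly_tangent[OF t y_def] d by simp
  then consider "x = 0" | "x \<noteq> 0" "y = 0" | "x \<noteq> 0" "y \<noteq> 0" "hN x y = 0" by auto
  then show False
  proof cases
    case 1
    then have "q = 0" using root q by (simp add: hpoly_def)
    then show False using d p 1 by (simp add: hpoly_def pderiv_pCons)
  next
    case 2
    then have q: "q = p * x" by (simp add: y_def)
    have "hB x y = 0" using pB 2 p by (simp add: hA_def)
    then have "x ^ 3 = - 1" using 2 by (simp add: hB_def) algebra
    then have "p ^ 3 + q ^ 3 = 0" unfolding q by (simp add: power_mult_distrib)
    then show False using pq by simp
  next
    case 3
    have "hA x y ^ 3 = hB x y ^ 3" using hA3_minus_hB3[of x y] 3 by simp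
    then have "(p ^ 3 + 1) * hB x y ^ 3 = 0" unfolding pB by (simp add: power_mult_distrib) algebra
    then have B: "hB x y = 0" using p by (simp add: add_eq_0_iff2)
    with pB have "hA x y = 0" by simp
    with B 3 have e: "2 * y ^ 3 - x ^ 3 - 1 = 0" "2 * x ^ 3 - y ^ 3 - 1 = 0" by (auto simp: hA_def hB_def)
    have x: "x ^ 3 = 1" and y: "y ^ 3 = 1" using e by algebra+
    have e6: "6 * x\<^sup>2 * y - 2 * p * (x ^ 3 + y ^ 3 + 1) + 6 * p\<^sup>2 * x * y\<^sup>2 = 0"
      using d unfolding poly_pderiv_hpoly y_def .
    define c where "c = x\<^sup>2 * y"
    have c3: "c ^ 3 = 1" and c2: "x * y\<^sup>2 = c\<^sup>2"
    proof -
      have "c ^ 3 = (x ^ 3)\<^sup>2 * y ^ 3" unfolding c_def by algebra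
      then show "c ^ 3 = 1" using x y by simp
      have "c\<^sup>2 = x ^ 3 * (x * y\<^sup>2)" unfolding c_def by algebra
      then show "x * y\<^sup>2 = c\<^sup>2" using x by simp
    qed
    have "6 * (c - p + p\<^sup>2 * c\<^sup>2) = 0"
      using e6 x y unfolding c2[symmetric] unfolding c_def by (simp add: algebra_simps)
    then have "c + p\<^sup>2 * c\<^sup>2 = p" by algebra
    \<comment> \<open>With \<open>p = c s\<close> and \<open>c ^ 3 = 1\<close> the equation becomes
      \<open>s ^ 2 - s + 1 = 0\<close>; the factor \<open>p + c\<close> corresponds to
      \<open>s + 1\<close> and completes it to \<open>s ^ 3 + 1\<close>, that is
      \<open>p ^ 3 + 1\<close>.\<close>
    then have "(p + c) * c * (c + p\<^sup>2 * c\<^sup>2) = (p + c) * c * p" by simp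
    then have "p ^ 3 * c ^ 3 + p * c\<^sup>2 + p\<^sup>2 * c * c ^ 3 + c ^ 3 = p\<^sup>2 * c + p * c\<^sup>2" by algebra
    then have "p ^ 3 + 1 = 0" unfolding c3 by simp
    then show False using p by (simp add: add_eq_0_iff2)
  qed
qed

text \<open>The tangent at \<open>(x, y)\<close> has \<open>p = - A / B\<close> and
  \<open>q = C / B\<close>. The conditions on \<open>A\<close> and on the cubes make its tangency
  roots simple, and the last one says that the tangent is not \<open>l\<close> itself.\<close>

lemma flat_at_generic_point:
  assumes flat: "flat_web 5 (Leg l hesse)"
    and l: "l$1 * x + l$2 * y + l$3 = 0"
    and A: "hA x y \<noteq> 0" and B: "hB x y \<noteq> 0"
    and AB: "hA x y ^ 3 \<noteq> hB x y ^ 3" and CB: "hC x y ^ 3 \<noteq> hB x y ^ 3" and CA: "hC x y ^ 3 \<noteq> hA x y ^ 3"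
    and T: "l$1 * hB x y - l$2 * hA x y \<noteq> 0"
  shows "l$1 * x * (x ^ 6 - 7 * y ^ 3) + l$2 * y * (y ^ 6 - 7 * x ^ 3) + l$3 * (1 - 7 * x ^ 3 * y ^ 3) = 0"
proof -
  define p where "p = - hA x y / hB x y"
  define q where "q = p * x - y"
  have pB: "p * hB x y = - hA x y" using B by (simp add: p_def)
  \<comment> \<open>The Euler relation \<open>x A + y B + C = 0\<close> gives
    \<open>p x - y = C / B\<close>.\<close>
  have qB: "q * hB x y = hC x y"
    using pB by (simp add: q_def left_diff_distrib) (simp add: hA_def hB_def hC_def, algebra)
  have y: "y = p * x - q" by (simp add: q_def)
  have t: "hA x y + p * hB x y = 0" using pB by simp
  have p0: "p \<noteq> 0" using A B by (simp add: p_def)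
  have "(p * hB x y) ^ 3 \<noteq> - (hB x y ^ 3)" "(q * hB x y) ^ 3 \<noteq> hB x y ^ 3" "(p * hB x y) ^ 3 + (q * hB x y) ^ 3 \<noteq> 0"
    using AB CB CA by (auto simp: pB qB)
  then have p1: "p ^ 3 \<noteq> - 1" and q1: "q ^ 3 \<noteq> 1" and pq: "p ^ 3 + q ^ 3 \<noteq> 0"
    by (auto simp: power_mult_distrib simp flip: distrib_right)
  have kB: "(l$1 + l$2 * p) * hB x y = l$1 * hB x y - l$2 * hA x y"
    using pB by algebra
  then have k: "l$1 + l$2 * p \<noteq> 0" using T by auto
  have r: "x = (l$2 * q - l$3) / (l$1 + l$2 * p)"
    using l k by (simp add: eq_divide_eq q_def) algebra
  have root: "poly (hpoly (p, q)) x = 0" using t by (simp add: poly_hpoly flip: y)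
  define Px where "Px = poly (pderiv (hpoly (p, q))) x"
  have "hB x y * (12 * x * y * (1 + p ^ 3)) * (l$1 + l$2 * p) =
      6 * Px * (l$2 * Px + (l$1 + l$2 * p) * poly (hpoly_q (p, q)) x)"
    using flat_at_simple_tangency[OF flat p0 p1 k r root hpoly_roots_simple[OF p0 p1 q1 pq]] B
    unfolding poly_hpoly_p poly_pderiv2_hpoly y[symmetric] Px_def by blast
  \<comment> \<open>Three factors \<open>B\<close> suffice on both sides: on the left they turn
    \<open>1 + p ^ 3\<close> into \<open>B ^ 3 + (p B) ^ 3\<close>, on the right two of them give
    \<open>Px\<close> the square required by \<open>pderiv_hpoly_tangent\<close> and the third forms
    \<open>W\<close>.\<close>
  then have "hB x y ^ 3 * (hB x y * (12 * x * y * (1 + p ^ 3)) * (l$1 + l$2 * p)) =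
      hB x y ^ 3 * (6 * Px * (l$2 * Px + (l$1 + l$2 * p) * poly (hpoly_q (p, q)) x))"
    by simp
  then have main: "12 * x * y * (hB x y ^ 3 + (p * hB x y) ^ 3) * ((l$1 + l$2 * p) * hB x y) =
      6 * ((hB x y)\<^sup>2 * Px) * (hB x y * (l$2 * Px + (l$1 + l$2 * p) * poly (hpoly_q (p, q)) x))"
    by algebra
  define W where "W = l$2 * (hB x y * (6 * x\<^sup>2 * y) - hA x y * (2 * y ^ 3 - 4 * x ^ 3 - 1)) -
      l$1 * (hB x y * (2 * x ^ 3 - 4 * y ^ 3 - 1) - hA x y * (6 * x * y\<^sup>2))"
  have W: "hB x y * (l$2 * Px + (l$1 + l$2 * p) * poly (hpoly_q (p, q)) x) = W"
    using pB unfolding Px_def poly_pderiv_hpoly poly_hpoly_q y[symmetric] W_def by algebra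
  have E: "(hB x y)\<^sup>2 * Px = 2 * x * y * hN x y"
    unfolding Px_def by (rule pderiv_hpoly_tangent[OF t y])
  have "12 * x * y * (hB x y ^ 3 + (- hA x y) ^ 3) = - 6 * (x ^ 3 - y ^ 3) * (2 * x * y * hN x y)"
    using hA3_minus_hB3[of x y] by algebra
  then have "(2 * x * y * hN x y) * ((x ^ 3 - y ^ 3) * (l$1 * hB x y - l$2 * hA x y) + W) = 0"
    using main unfolding E W kB pB by algebra
  moreover have "2 * x * y * hN x y \<noteq> 0"
    using AB hA3_minus_hB3[of x y] A B by (auto simp: hA_def hB_def)
  ultimately have "(x ^ 3 - y ^ 3) * (l$1 * hB x y - l$2 * hA x y) + W = 0" by simp
  moreover have l3: "l$3 = - (l$1 * x + l$2 * y)" using l by algebra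
  ultimately show ?thesis
    unfolding W_def l3 hA_def hB_def by algebra
qed

section \<open>Polynomials vanishing on a line\<close>

text \<open>Only the restrictions to parametrised lines \<open>u + s v\<close> are required to be
  polynomial. This is stable under the ring operations and reduces everything to univariate
  polynomials.\<close>

definition polyfun :: "(complex^3 \<Rightarrow> complex) \<Rightarrow> bool" where
  "polyfun f \<longleftrightarrow> (\<forall>u v. \<exists>P. \<forall>s. f (u + s *s v) = poly P s)"

lemma polyfun_const: "polyfun (\<lambda>m. c)"
  unfolding polyfun_def by (metis poly_0 poly_pCons mult_zero_right add.right_neutral)

lemma polyfun_nth: "polyfun (\<lambda>m. m $ i)"
  unfolding polyfun_def
proof (intro allI)
  fix u v :: "complex^3"
  show "\<exists>P. \<forall>s. (u + s *s v) $ i = poly P s"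
    by (intro exI[of _ "[:u $ i, v $ i:]"]) simp
qed

lemma polyfun_add: "polyfun f \<Longrightarrow> polyfun g \<Longrightarrow> polyfun (\<lambda>m. f m + g m)"
  unfolding polyfun_def by (metis poly_add)

lemma polyfun_diff: "polyfun f \<Longrightarrow> polyfun g \<Longrightarrow> polyfun (\<lambda>m. f m - g m)"
  unfolding polyfun_def by (metis poly_diff)

lemma polyfun_mult: "polyfun f \<Longrightarrow> polyfun g \<Longrightarrow> polyfun (\<lambda>m. f m * g m)"
  unfolding polyfun_def by (metis poly_mult)

lemma polyfun_power: "polyfun f \<Longrightarrow> polyfun (\<lambda>m. f m ^ n)"
  unfolding polyfun_def by (metis poly_power)

lemmas polyfun_intros = polyfun_const polyfun_nth polyfun_add polyfun_diff polyfun_mult polyfun_power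

definition vanishes_on_line :: "complex^3 \<Rightarrow> (complex^3 \<Rightarrow> complex) \<Rightarrow> bool" where
  "vanishes_on_line l f \<longleftrightarrow> (\<forall>m. scalar_product l m = 0 \<longrightarrow> f m = 0)"

text \<open>Take a point of the line where \<open>f\<close> is nonzero and one where
  \<open>g\<close> is. Along the parametrised line joining them both factors are nonzero univariate
  polynomials, so their product cannot vanish for all parameters.\<close>

lemma vanishes_on_line_mult:
  assumes "polyfun f" "polyfun g" "vanishes_on_line l (\<lambda>m. f m * g m)"
  shows "vanishes_on_line l f \<or> vanishes_on_line l g"
proof (rule ccontr)
  assume "\<not> ?thesis"
  then obtain u w where u: "scalar_product l u = 0" "f u \<noteq> 0" and w: "scalar_product l w = 0" "g w \<noteq> 0"
    by (auto simp: vanishes_on_line_def)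
  obtain P Q where P: "\<And>s. f (u + s *s (w - u)) = poly P s" and Q: "\<And>s. g (u + s *s (w - u)) = poly Q s"
    using assms(1,2) unfolding polyfun_def by metis
  have "poly (P * Q) s = 0" for s
  proof -
    have "scalar_product l (u + s *s (w - u)) = 0"
      using u w by (simp add: scalar_product_def sum_3 algebra_simps) algebra
    then show ?thesis using assms(3) by (simp add: vanishes_on_line_def flip: P Q)
  qed
  then have "P * Q = 0" using poly_all_0_iff_0 by blast
  then have "P = 0 \<or> Q = 0" by simp
  then show False using P[of 0] Q[of 1] u w by auto
qed

lemma vanishes_on_lineD:
  assumes "vanishes_on_line l f" "l$1 * x + l$2 * y + l$3 * z = 0"
  shows "f (vector [x, y, z]) = 0"
  using assms by (simp add: vanishes_on_line_def scalar_product_def sum_3)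

lemma hesse_nth:
  "hesse m $ 1 = m$2 * m$3 * (2 * m$1 ^ 3 - m$2 ^ 3 - m$3 ^ 3)"
  "hesse m $ 2 = m$1 * m$3 * (2 * m$2 ^ 3 - m$1 ^ 3 - m$3 ^ 3)"
  "hesse m $ 3 = m$1 * m$2 * (2 * m$3 ^ 3 - m$1 ^ 3 - m$2 ^ 3)"
  by (simp_all add: hesse_def Let_def)

lemma vec3_eq_0_iff: "(l :: complex^3) = 0 \<longleftrightarrow> l$1 = 0 \<and> l$2 = 0 \<and> l$3 = 0"
  by (simp add: vec_eq_iff forall_3)

lemma invariant_lineI:
  assumes "\<And>m. scalar_product l m = 0 \<Longrightarrow> \<exists>k. hesse m = k *s l"
  shows "invariant_line hesse l"
  unfolding invariant_line_def tangent_at_def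
proof (intro allI impI)
  fix m w assume "scalar_product l m = 0" and w: "scalar_product l w = 0"
  then obtain k where "hesse m = k *s l" using assms by blast
  then have "scalar_product (hesse m) w = k * scalar_product l w"
    by (simp add: scalar_product_def sum_3 algebra_simps)
  then show "scalar_product (hesse m) w = 0" using w by simp
qed

lemma invariant_coordinate_line:
  assumes "l$1 = 0 \<and> l$2 = 0 \<or> l$1 = 0 \<and> l$3 = 0 \<or> l$2 = 0 \<and> l$3 = 0" "l \<noteq> 0"
  shows "invariant_line hesse l"
proof (rule invariant_lineI)
  fix m assume m: "scalar_product l m = 0"
  have "l$1 \<noteq> 0 \<or> l$2 \<noteq> 0 \<or> l$3 \<noteq> 0" using assms(2) by (auto simp: vec3_eq_0_iff)
  with assms(1) consider "l$1 = 0" "l$2 = 0" "l$3 \<noteq> 0" | "l$1 = 0" "l$3 = 0" "l$2 \<noteq> 0" | "l$2 = 0" "l$3 = 0" "l$1 \<noteq> 0"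
    by auto
  then show "\<exists>k. hesse m = k *s l"
  proof cases
    case 1
    then have "m$3 = 0" using m by (simp add: scalar_product_def sum_3)
    then show ?thesis using 1 by (intro exI[of _ "hesse m $ 3 / l$3"]) (simp add: vec_eq_iff forall_3 hesse_nth)
  next
    case 2
    then have "m$2 = 0" using m by (simp add: scalar_product_def sum_3)
    then show ?thesis using 2 by (intro exI[of _ "hesse m $ 2 / l$2"]) (simp add: vec_eq_iff forall_3 hesse_nth)
  next
    case 3
    then have "m$1 = 0" using m by (simp add: scalar_product_def sum_3)
    then show ?thesis using 3 by (intro exI[of _ "hesse m $ 1 / l$1"]) (simp add: vec_eq_iff forall_3 hesse_nth)
  qed
qed

lemma invariant_equal_cubes:
  assumes "l$1 ^ 3 = l$3 ^ 3" "l$2 ^ 3 = l$3 ^ 3" "l \<noteq> 0"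
  shows "invariant_line hesse l"
proof -
  have False: "l$3 \<noteq> 0" using assms by (auto simp: vec3_eq_0_iff)
  show ?thesis
  proof (rule invariant_lineI)
    fix m assume m: "scalar_product l m = 0"
    define \<alpha> \<beta> where "\<alpha> = l$1 / l$3" and "\<beta> = l$2 / l$3"
    have ab: "\<alpha> ^ 3 = 1" "\<beta> ^ 3 = 1" using assms False by (simp_all add: \<alpha>_def \<beta>_def power_divide)
    have "l$3 * (\<alpha> * m$1 + \<beta> * m$2 + m$3) = scalar_product l m"
      using False by (simp add: \<alpha>_def \<beta>_def scalar_product_def sum_3 field_simps)
    then have z: "m$3 = - \<alpha> * m$1 - \<beta> * m$2" using m False by simp algebra
    have 1: "hesse m $ 1 = \<alpha> * hesse m $ 3"
      unfolding hesse_nth z using ab by algebra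
    have 2: "hesse m $ 2 = \<beta> * hesse m $ 3"
      unfolding hesse_nth z using ab by algebra
    show "\<exists>k. hesse m = k *s l"
      using False 1 2 by (intro exI[of _ "hesse m $ 3 / l$3"]) (simp add: vec_eq_iff forall_3 \<alpha>_def \<beta>_def)
  qed
qed

section \<open>The lines along which flatness is possible\<close>

text \<open>These nine lines are the harmonic polars of the nine radial singularities.\<close>

definition harmonic_polar :: "complex^3 \<Rightarrow> bool" where
  "harmonic_polar l \<longleftrightarrow> l$1 = 0 \<and> l$2 ^ 3 + l$3 ^ 3 = 0 \<or> l$2 = 0 \<and> l$1 ^ 3 + l$3 ^ 3 = 0 \<or>
     l$3 = 0 \<and> l$1 ^ 3 + l$2 ^ 3 = 0"

text \<open>The vectors tried here and below, such as \<open>(l$3, 0, - l$1)\<close>, represent the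
  intersections of \<open>l\<close> with the coordinate lines.\<close>

lemma vanishes_coordinate:
  assumes "vanishes_on_line l (\<lambda>m. m $ i)" "l \<noteq> 0"
  shows "invariant_line hesse l"
proof -
  note v = vanishes_on_lineD[OF assms(1)]
  have "l$1 = 0 \<and> l$2 = 0 \<or> l$1 = 0 \<and> l$3 = 0 \<or> l$2 = 0 \<and> l$3 = 0"
    using v[of "l$3" 0 "- l$1"] v[of 0 "l$3" "- l$2"] v[of "l$2" "- l$1" 0] exhaust_3[of i]
    by (auto simp: mult.commute)
  then show ?thesis using assms(2) by (rule invariant_coordinate_line)
qed

lemma vanishes_diff_cubes:
  assumes "vanishes_on_line l (\<lambda>m. m $ i ^ 3 - m $ j ^ 3)" "i \<noteq> j"
  shows "harmonic_polar l"
proof -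
  note v = vanishes_on_lineD[OF assms(1)]
  have "(i = 1 \<or> i = 2 \<or> i = 3) \<and> (j = 1 \<or> j = 2 \<or> j = 3)" using exhaust_3 by auto
  then show ?thesis
    using v[of "l$3" 0 "- l$1"] v[of 0 "l$3" "- l$2"] v[of "l$2" "- l$1" 0] assms(2)
    by (auto simp: mult.commute harmonic_polar_def neg_eq_iff_add_eq_0 add.commute)
qed

lemma vanishes_hesse_pencil:
  assumes "vanishes_on_line l (\<lambda>m. (m$1 ^ 3 + m$2 ^ 3 + m$3 ^ 3) ^ 3 - 27 * m$1 ^ 3 * m$2 ^ 3 * m$3 ^ 3)" "l \<noteq> 0"
  shows "invariant_line hesse l"
proof -
  note v = vanishes_on_lineD[OF assms(1)]
  have "l$1 ^ 3 = l$3 ^ 3" "l$2 ^ 3 = l$3 ^ 3"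
    using v[of "l$3" 0 "- l$1"] v[of 0 "l$3" "- l$2"] by (auto simp: mult.commute)
  then show ?thesis using assms(2) by (rule invariant_equal_cubes)
qed

lemma UNIV_3_cases:
  assumes "{i, j, k} = (UNIV :: 3 set)"
  shows "i = 1 \<and> (j = 2 \<and> k = 3 \<or> j = 3 \<and> k = 2) \<or> i = 2 \<and> (j = 1 \<and> k = 3 \<or> j = 3 \<and> k = 1) \<or>
      i = 3 \<and> (j = 1 \<and> k = 2 \<or> j = 2 \<and> k = 1)"
proof -
  have "i = 1 \<or> i = 2 \<or> i = 3" "j = 1 \<or> j = 2 \<or> j = 3" "k = 1 \<or> k = 2 \<or> k = 3" using exhaust_3 by auto
  moreover have "1 \<in> {i, j, k}" "2 \<in> {i, j, k}" "3 \<in> {i, j, k}" using assms by auto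
  ultimately show ?thesis by auto
qed

text \<open>A smooth cubic of Fermat type contains no line. Two intersections with coordinate lines
  and the point \<open>(c, c, - a - b)\<close> of the line already force all its coefficients to be
  zero.\<close>

lemma not_vanishes_cubic:
  assumes "vanishes_on_line l (\<lambda>m. 2 * m$i ^ 3 - m$j ^ 3 - m$k ^ 3)" "{i, j, k} = UNIV" "l \<noteq> 0"
  shows False
proof -
  note ijk = UNIV_3_cases[OF assms(2)]
  define a b c where "a = l$i" and "b = l$j" and "c = l$k"
  have v: "2 * x ^ 3 - y ^ 3 - z ^ 3 = 0" if "a * x + b * y + c * z = 0" for x y z
  proof -
    define m :: "complex^3" where "m = (\<chi> n. if n = i then x else if n = j then y else z)"
    have m: "m$i = x" "m$j = y" "m$k = z" using ijk by (auto simp: m_def)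
    have "scalar_product l m = a * x + b * y + c * z"
      unfolding scalar_product_def sum_3 using ijk m by (auto simp: a_def b_def c_def)
    then have "2 * m$i ^ 3 - m$j ^ 3 - m$k ^ 3 = 0"
      using assms(1) that unfolding vanishes_on_line_def by metis
    then show ?thesis by (simp only: m)
  qed
  have 1: "c ^ 3 = b ^ 3" using v[of 0 c "- b"] by simp
  have 2: "2 * c ^ 3 + a ^ 3 = 0" using v[of c 0 "- a"] by simp
  have 3: "2 * c ^ 3 - c ^ 3 + (a + b) ^ 3 = 0" 
  proof -
    have "a * c + b * c + c * (- a - b) = 0" by algebra
    from v[OF this] show ?thesis by algebra
  qed
  have "a * b * (a + b) = 0" using 1 2 3 by algebra
  then have "a = 0 \<or> b = 0 \<or> a = - b" by (auto simp: add_eq_0_iff2)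
  then have "a = 0 \<and> b = 0 \<and> c = 0"
    using 1 2 by auto
  then show False using assms(3) ijk by (auto simp: a_def b_def c_def vec3_eq_0_iff)
qed

text \<open>For a line without zero coefficient, its points on the coordinate lines give only
  \<open>a ^ 6 = b ^ 6 = c ^ 6\<close>, that is equality of the cubes up to sign. The points built
  from primitive cube roots of unity exclude the mixed signs.\<close>

lemma vanishes_septic:
  assumes "vanishes_on_line l (\<lambda>m. l$1 * m$1 * (m$1 ^ 6 - 7 * m$2 ^ 3 * m$3 ^ 3) +
      l$2 * m$2 * (m$2 ^ 6 - 7 * m$1 ^ 3 * m$3 ^ 3) + l$3 * m$3 * (m$3 ^ 6 - 7 * m$1 ^ 3 * m$2 ^ 3))"
    and "l \<noteq> 0"
  shows "invariant_line hesse l \<or> harmonic_polar l"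
proof -
  define a b c where "a = l$1" and "b = l$2" and "c = l$3"
  have v: "a * x * (x ^ 6 - 7 * y ^ 3 * z ^ 3) + b * y * (y ^ 6 - 7 * x ^ 3 * z ^ 3) + c * z * (z ^ 6 - 7 * x ^ 3 * y ^ 3) = 0"
    if "a * x + b * y + c * z = 0" for x y z
    using vanishes_on_lineD[OF assms(1)] that by (simp add: a_def b_def c_def)
  show ?thesis
  proof (cases "a = 0 \<and> b = 0 \<or> a = 0 \<and> c = 0 \<or> b = 0 \<and> c = 0")
    case True
    then show ?thesis using invariant_coordinate_line[of l] assms(2) by (simp add: a_def b_def c_def)
  next
    case False
    then consider "a = 0" "b \<noteq> 0" "c \<noteq> 0" | "b = 0" "a \<noteq> 0" "c \<noteq> 0" | "c = 0" "a \<noteq> 0" "b \<noteq> 0" |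
      "a \<noteq> 0" "b \<noteq> 0" "c \<noteq> 0" by blast
    then show ?thesis
    proof cases
      case 1
      \<comment> \<open>With \<open>a = 0\<close> the coordinate \<open>x\<close> is free. The value
        \<open>x = 0\<close> gives \<open>b ^ 6 = c ^ 6\<close>, and \<open>x = 1\<close> then adds
        the term \<open>7 * (b ^ 3 + c ^ 3)\<close>.\<close>
      have "b * c * (b ^ 3 + c ^ 3) = 0" using v[of 0 c "- b"] v[of 1 c "- b"] 1 by (simp; algebra)
      then have "harmonic_polar l" using 1 by (simp add: harmonic_polar_def a_def b_def c_def)
      then show ?thesis ..
    next
      case 2
      have "a * c * (a ^ 3 + c ^ 3) = 0" using v[of c 0 "- a"] v[of c 1 "- a"] 2 by (simp; algebra)
      then have "harmonic_polar l" using 2 by (simp add: harmonic_polar_def a_def b_def c_def)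
      then show ?thesis ..
    next
      case 3
      have "a * b * (a ^ 3 + b ^ 3) = 0" using v[of b "- a" 0] v[of b "- a" 1] 3 by (simp; algebra)
      then have "harmonic_polar l" using 3 by (simp add: harmonic_polar_def a_def b_def c_def)
      then show ?thesis ..
    next
      case 4
      have ab: "a ^ 6 = b ^ 6" using v[of b "- a" 0] 4 by (simp; algebra)
      have ac: "a ^ 6 = c ^ 6" using v[of c 0 "- a"] 4 by (simp; algebra)
      \<comment> \<open>evaluate at the point \<open>(b c, w a c, w\<^sup>2 a b)\<close> of the line\<close>
      have w: "a ^ 3 + w * b ^ 3 + w\<^sup>2 * c ^ 3 = 0" if w: "w\<^sup>2 + w + 1 = 0" for w
      proof -
        have "a * (b * c) + b * (w * a * c) + c * (w\<^sup>2 * a * b) = a * b * c * (w\<^sup>2 + w + 1)" by algebra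
        then have 0: "a * (b * c) + b * (w * a * c) + c * (w\<^sup>2 * a * b) = 0" using w by simp
        have w3: "w ^ 3 = 1" using w by algebra
        define K where "K = a ^ 6"
        have cubes: "(b * c) ^ 6 = K\<^sup>2" "(w * a * c) ^ 6 = K\<^sup>2" "(w\<^sup>2 * a * b) ^ 6 = K\<^sup>2"
          "(w * a * c) ^ 3 * (w\<^sup>2 * a * b) ^ 3 = K * (b ^ 3 * c ^ 3)"
          "(b * c) ^ 3 * (w\<^sup>2 * a * b) ^ 3 = K * (a ^ 3 * c ^ 3)"
          "(b * c) ^ 3 * (w * a * c) ^ 3 = K * (a ^ 3 * b ^ 3)"
        proof -
          have w6: "w ^ 6 = 1" "w ^ 12 = 1" using w3 power_mult[of w 3 2] power_mult[of w 3 4] by simp_all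
          have K: "b ^ 6 = K" "c ^ 6 = K" "a ^ 6 = K" using ab ac by (simp_all add: K_def)
          show "(b * c) ^ 6 = K\<^sup>2" "(w * a * c) ^ 6 = K\<^sup>2" "(w\<^sup>2 * a * b) ^ 6 = K\<^sup>2"
            by (simp_all add: power_mult_distrib w6 K power2_eq_square flip: power_mult)
          have "(w * a * c) ^ 3 * (w\<^sup>2 * a * b) ^ 3 = (w ^ 3) ^ 3 * a ^ 6 * (b ^ 3 * c ^ 3)"
            "(b * c) ^ 3 * (w\<^sup>2 * a * b) ^ 3 = (w ^ 3)\<^sup>2 * b ^ 6 * (a ^ 3 * c ^ 3)"
            "(b * c) ^ 3 * (w * a * c) ^ 3 = w ^ 3 * c ^ 6 * (a ^ 3 * b ^ 3)"
            by algebra+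
          then show "(w * a * c) ^ 3 * (w\<^sup>2 * a * b) ^ 3 = K * (b ^ 3 * c ^ 3)"
            "(b * c) ^ 3 * (w\<^sup>2 * a * b) ^ 3 = K * (a ^ 3 * c ^ 3)"
            "(b * c) ^ 3 * (w * a * c) ^ 3 = K * (a ^ 3 * b ^ 3)"
            unfolding w3 K by simp_all
        qed
        have "a * (b * c) * (K\<^sup>2 - 7 * (K * (b ^ 3 * c ^ 3))) + b * (w * a * c) * (K\<^sup>2 - 7 * (K * (a ^ 3 * c ^ 3))) +
            c * (w\<^sup>2 * a * b) * (K\<^sup>2 - 7 * (K * (a ^ 3 * b ^ 3))) = 0"
          using v[OF 0] unfolding mult.assoc[of 7] cubes .
        moreover have "a * (b * c) * (K\<^sup>2 - 7 * (K * (b ^ 3 * c ^ 3))) + b * (w * a * c) * (K\<^sup>2 - 7 * (K * (a ^ 3 * c ^ 3))) +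
            c * (w\<^sup>2 * a * b) * (K\<^sup>2 - 7 * (K * (a ^ 3 * b ^ 3))) =
            a * b * c * (K\<^sup>2 * (w\<^sup>2 + w + 1) - 7 * K * (b ^ 3 * c ^ 3 + w * (a ^ 3 * c ^ 3) + w\<^sup>2 * (a ^ 3 * b ^ 3)))"
          by algebra
        ultimately have "b ^ 3 * c ^ 3 + w * (a ^ 3 * c ^ 3) + w\<^sup>2 * (a ^ 3 * b ^ 3) = 0"
          using w 4 by (simp add: K_def)
        then have "a ^ 3 * b ^ 3 * c ^ 3 * (b ^ 3 * c ^ 3 + w * (a ^ 3 * c ^ 3) + w\<^sup>2 * (a ^ 3 * b ^ 3)) = 0" by simp
        moreover have "a ^ 3 * b ^ 3 * c ^ 3 * (b ^ 3 * c ^ 3 + w * (a ^ 3 * c ^ 3) + w\<^sup>2 * (a ^ 3 * b ^ 3)) =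
            a ^ 3 * (b ^ 6 * c ^ 6) + w * b ^ 3 * (a ^ 6 * c ^ 6) + w\<^sup>2 * c ^ 3 * (a ^ 6 * b ^ 6)"
          by algebra
        ultimately have "K\<^sup>2 * (a ^ 3 + w * b ^ 3 + w\<^sup>2 * c ^ 3) = 0"
          using ab ac by (simp add: K_def algebra_simps power2_eq_square)
        then show ?thesis using 4 by (simp add: K_def)
      qed
      define w where "w = Complex (- 1 / 2) (sqrt 3 / 2)"
      have w1: "w\<^sup>2 + w + 1 = 0" by (simp add: w_def complex_eq_iff power2_eq_square)
      \<comment> \<open>\<open>- 1 - w\<close> is the other primitive cube root of unity;
        subtracting the two relations leaves the factor \<open>2 * w + 1\<close>, which is the
        difference of the two roots.\<close>
      have w2: "(- 1 - w)\<^sup>2 + (- 1 - w) + 1 = 0" using w1 by algebra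
      have ne: "2 * w + 1 \<noteq> 0" by (simp add: w_def complex_eq_iff)
      have "(2 * w + 1) * (b ^ 3 - c ^ 3) = 0" using w[OF w1] w[OF w2] w1 by algebra
      then have bc: "b ^ 3 = c ^ 3" using ne by simp
      have "a ^ 3 = c ^ 3" using w[OF w1] w1 unfolding bc by algebra
      then have "invariant_line hesse l"
        using bc assms(2) by (intro invariant_equal_cubes) (simp_all add: a_def b_def c_def)
      then show ?thesis ..
    qed
  qed
qed

text \<open>The genericity conditions of \<open>flat_at_generic_point\<close> and the septic itself
  are all polynomial. If none of them vanishes identically on the line, then neither does their
  product, and a point where it is nonzero contradicts flatness.\<close>

lemma flat_imp_harmonic:
  assumes l: "l \<noteq> 0" and not_inv: "\<not> invariant_line hesse l"
    and flat: "flat_web 5 (Leg l hesse)"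
  shows "harmonic_polar l"
proof (rule ccontr)
  assume not_harm: "\<not> harmonic_polar l"
  define A B C where "A m = hesse m $ 1" and "B m = hesse m $ 2" and "C m = hesse m $ 3" for m
  define N where "N m = (m$1 ^ 3 + m$2 ^ 3 + m$3 ^ 3) ^ 3 - 27 * m$1 ^ 3 * m$2 ^ 3 * m$3 ^ 3" for m :: "complex^3"
  define T where "T m = l$1 * B m - l$2 * A m" for m
  define F where "F m = l$1 * m$1 * (m$1 ^ 6 - 7 * m$2 ^ 3 * m$3 ^ 3) +
      l$2 * m$2 * (m$2 ^ 6 - 7 * m$1 ^ 3 * m$3 ^ 3) + l$3 * m$3 * (m$3 ^ 6 - 7 * m$1 ^ 3 * m$2 ^ 3)" for m :: "complex^3"
  have A: "A = (\<lambda>m. m$2 * (m$3 * (2 * m$1 ^ 3 - m$2 ^ 3 - m$3 ^ 3)))"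
    and B: "B = (\<lambda>m. m$1 * (m$3 * (2 * m$2 ^ 3 - m$1 ^ 3 - m$3 ^ 3)))"
    and C: "C = (\<lambda>m. m$1 * (m$2 * (2 * m$3 ^ 3 - m$1 ^ 3 - m$2 ^ 3)))"
    by (auto simp: A_def B_def C_def hesse_nth)
  have AB: "(\<lambda>m. A m ^ 3 - B m ^ 3) = (\<lambda>m. m$3 ^ 3 * ((m$1 ^ 3 - m$2 ^ 3) * N m))"
    and CB: "(\<lambda>m. C m ^ 3 - B m ^ 3) = (\<lambda>m. m$1 ^ 3 * ((m$3 ^ 3 - m$2 ^ 3) * N m))"
    and CA: "(\<lambda>m. C m ^ 3 - A m ^ 3) = (\<lambda>m. m$2 ^ 3 * ((m$3 ^ 3 - m$1 ^ 3) * N m))"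
    unfolding A B C N_def by (rule ext, algebra)+
  have pN: "polyfun N" and pA: "polyfun A" and pB: "polyfun B" and pC: "polyfun C"
    unfolding N_def[abs_def] A B C by (intro polyfun_intros)+
  have pT: "polyfun T" unfolding T_def[abs_def] by (intro polyfun_intros pA pB)
  have pF: "polyfun F" unfolding F_def[abs_def] by (intro polyfun_intros)
  have coord: "\<not> vanishes_on_line l (\<lambda>m. m $ i)" for i
    using vanishes_coordinate not_inv l by blast
  have coord3: "\<not> vanishes_on_line l (\<lambda>m. m $ i ^ 3)" for i
    using coord[of i] by (simp add: vanishes_on_line_def)
  have diff: "\<not> vanishes_on_line l (\<lambda>m. m $ i ^ 3 - m $ j ^ 3)" if "i \<noteq> j" for i j
    using vanishes_diff_cubes[OF _ that] not_harm by blast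
  have nN: "\<not> vanishes_on_line l N"
    using vanishes_hesse_pencil not_inv l by (auto simp: N_def[abs_def])
  have cubic: "\<not> vanishes_on_line l (\<lambda>m. 2 * m$i ^ 3 - m$j ^ 3 - m$k ^ 3)" if "{i, j, k} = UNIV" for i j k
    using not_vanishes_cubic[OF _ that l] by blast
  have nprod: "\<not> vanishes_on_line l (\<lambda>m. f m * g m)"
    if "\<not> vanishes_on_line l f" "\<not> vanishes_on_line l g" "polyfun f" "polyfun g" for f g
    using vanishes_on_line_mult that by blast
  have nA: "\<not> vanishes_on_line l A"
    unfolding A by (intro nprod coord cubic polyfun_intros UNIV_3[symmetric])
  have nB: "\<not> vanishes_on_line l B"
    unfolding B by (intro nprod coord cubic polyfun_intros) (simp add: UNIV_3 insert_commute)
  have nAB: "\<not> vanishes_on_line l (\<lambda>m. A m ^ 3 - B m ^ 3)"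
    and nCB: "\<not> vanishes_on_line l (\<lambda>m. C m ^ 3 - B m ^ 3)"
    and nCA: "\<not> vanishes_on_line l (\<lambda>m. C m ^ 3 - A m ^ 3)"
    unfolding AB CB CA by (intro nprod coord3 diff nN polyfun_intros pN; simp)+
  have nF: "\<not> vanishes_on_line l F"
    using vanishes_septic[of l] not_inv not_harm l by (auto simp: F_def[abs_def])
  have nT: "\<not> vanishes_on_line l T"
  proof
    assume T: "vanishes_on_line l T"
    \<comment> \<open>\<open>T = 0\<close> says that \<open>l\<close> and the form are proportional
      in their first two entries. Euler's relation and the equation of the line give the remaining
      minors, but only after multiplication by \<open>m$3\<close>, which is then cancelled by
      \<open>vanishes_on_line_mult\<close>.\<close>
    have inv: "vanishes_on_line l (\<lambda>m. m$3 * (l$i * hesse m $ j - l$j * hesse m $ i))" for i j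
      unfolding vanishes_on_line_def
    proof (intro allI impI)
      fix m assume m: "scalar_product l m = 0"
      have t: "l$1 * hesse m $ 2 = l$2 * hesse m $ 1" using T m by (simp add: vanishes_on_line_def T_def A_def B_def)
      have m': "l$1 * m$1 + l$2 * m$2 + l$3 * m$3 = 0" using m by (simp add: scalar_product_def sum_3)
      have e: "hesse m $ 1 * m$1 + hesse m $ 2 * m$2 + hesse m $ 3 * m$3 = 0"
        using hesse_euler[of m] by (simp add: scalar_product_def sum_3)
      have "m$3 * (l$1 * hesse m $ 3 - l$3 * hesse m $ 1) = 0" "m$3 * (l$2 * hesse m $ 3 - l$3 * hesse m $ 2) = 0"
        using t m' e by algebra+
      then show "m$3 * (l$i * hesse m $ j - l$j * hesse m $ i) = 0"
        using t exhaust_3[of i] exhaust_3[of j] by (auto simp: algebra_simps)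
    qed
    have par: "vanishes_on_line l (\<lambda>m. l$i * hesse m $ j - l$j * hesse m $ i)" for i j
    proof -
      have "polyfun (\<lambda>m. hesse m $ i)" for i
        using exhaust_3[of i] pA pB pC unfolding A_def[abs_def] B_def[abs_def] C_def[abs_def] by auto
      then have "polyfun (\<lambda>m. l$i * hesse m $ j - l$j * hesse m $ i)" by (intro polyfun_intros)
      then show ?thesis using vanishes_on_line_mult[OF polyfun_nth _ inv] coord by blast
    qed
    obtain i where i: "l $ i \<noteq> 0" using l by (auto simp: vec_eq_iff)
    have "invariant_line hesse l"
    proof (rule invariant_lineI)
      fix m assume "scalar_product l m = 0"
      then have "l$i * hesse m $ j = l$j * hesse m $ i" for j
        using par[of i j] by (simp add: vanishes_on_line_def)
      then show "\<exists>k. hesse m = k *s l"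
        using i by (intro exI[of _ "hesse m $ i / l $ i"]) (simp add: vec_eq_iff field_simps)
    qed
    with not_inv show False ..
  qed
  define G where "G m = m$3 * (A m * (B m * ((A m ^ 3 - B m ^ 3) * ((C m ^ 3 - B m ^ 3) * ((C m ^ 3 - A m ^ 3) * (T m * F m))))))" for m
  have "\<not> vanishes_on_line l G"
    unfolding G_def[abs_def] by (intro nprod coord nA nB nAB nCB nCA nT nF polyfun_intros pA pB pC pT pF)
  then obtain m where m: "scalar_product l m = 0" "G m \<noteq> 0" by (auto simp: vanishes_on_line_def)
  have z: "m$3 \<noteq> 0" using m by (auto simp: G_def)
  define x y where "x = m$1 / m$3" and "y = m$2 / m$3"
  have m12: "m$1 = m$3 * x" "m$2 = m$3 * y" using z by (simp_all add: x_def y_def)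
  have lx: "l$1 * x + l$2 * y + l$3 = 0"
  proof -
    have "m$3 * (l$1 * x + l$2 * y + l$3) = scalar_product l m"
      unfolding scalar_product_def sum_3 m12 by algebra
    then show ?thesis using m z by simp
  qed
  have hom: "A m = m$3 ^ 5 * hA x y" "B m = m$3 ^ 5 * hB x y" "C m = m$3 ^ 5 * hC x y"
    unfolding A B C hA_def hB_def hC_def m12 by algebra+
  have "T m = m$3 ^ 5 * (l$1 * hB x y - l$2 * hA x y)"
    unfolding T_def hom by algebra
  moreover have "F m = m$3 ^ 7 * (l$1 * x * (x ^ 6 - 7 * y ^ 3) + l$2 * y * (y ^ 6 - 7 * x ^ 3) + l$3 * (1 - 7 * x ^ 3 * y ^ 3))"
    unfolding F_def m12 by algebra
  ultimately have "F m = 0"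
    using flat_at_generic_point[OF flat lx] m(2) z by (simp add: G_def hom power_mult_distrib)
  then show False using m by (simp add: G_def)
qed

section \<open>Singularities on the harmonic polars\<close>

text \<open>Up to the factor 6 the hypotheses are the components of \<open>d \<Omega>\<close> at
  \<open>m\<close>, so the derivative \<open>J\<close> of the form, as a bilinear form, is
  symmetric. A radial linear part with factor \<open>c\<close> would give \<open>J e f = c\<close>
  and \<open>J f e = - c\<close>.\<close>

lemma curl_free_not_radial:
  assumes "m$3 * (m$2 ^ 3 - m$1 ^ 3) = 0" "m$1 * (m$3 ^ 3 - m$2 ^ 3) = 0" "m$2 * (m$1 ^ 3 - m$3 ^ 3) = 0"
  shows "\<not> radial_at hesse m"
proof
  assume "radial_at hesse m"
  then obtain e f c where c: "c \<noteq> 0"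
    and d: "(local_field hesse m e f has_derivative (\<lambda>(h, k). (c * h, c * k))) (at (0, 0))"
    by (auto simp: radial_at_def)
  define J where "J u w =
      (6 * m$1 ^ 2 * m$2 * m$3 * u$1 + m$3 * (2 * m$1 ^ 3 - 4 * m$2 ^ 3 - m$3 ^ 3) * u$2 + m$2 * (2 * m$1 ^ 3 - m$2 ^ 3 - 4 * m$3 ^ 3) * u$3) * w$1 +
      (m$3 * (2 * m$2 ^ 3 - 4 * m$1 ^ 3 - m$3 ^ 3) * u$1 + 6 * m$1 * m$2 ^ 2 * m$3 * u$2 + m$1 * (2 * m$2 ^ 3 - m$1 ^ 3 - 4 * m$3 ^ 3) * u$3) * w$2 +
      (m$2 * (2 * m$3 ^ 3 - 4 * m$1 ^ 3 - m$2 ^ 3) * u$1 + m$1 * (2 * m$3 ^ 3 - m$1 ^ 3 - 4 * m$2 ^ 3) * u$2 + 6 * m$1 * m$2 * m$3 ^ 2 * u$3) * w$3"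
    for u w :: "complex^3"
  have J: "((\<lambda>s. scalar_product (hesse (m + s *s u)) w) has_field_derivative J u w) (at 0)" for u w
    unfolding scalar_product_def sum_3 hesse_nth J_def vector_add_component vector_smult_component
    by (rule derivative_eq_intros | simp)+ (simp add: algebra_simps power2_eq_square power3_eq_cube)
  have 1: "((\<lambda>u. scalar_product (hesse (m + u *s e)) f) has_field_derivative c) (at 0)"
  proof -
    have "((\<lambda>u. (u, 0)) has_derivative (\<lambda>h. (h, 0))) (at (0::complex))"
      by (auto intro!: derivative_eq_intros)
    from has_derivative_compose[OF this d] have
      "((\<lambda>u. fst (local_field hesse m e f (u, 0))) has_derivative (\<lambda>h. fst (c * h, c * 0))) (at 0)"
      by (intro has_derivative_fst) (simp add: case_prod_unfold)
    then show ?thesis by (simp add: local_field_def has_field_derivative_def)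
  qed
  have 2: "((\<lambda>v. - scalar_product (hesse (m + v *s f)) e) has_field_derivative c) (at 0)"
  proof -
    have "((\<lambda>v. (0, v)) has_derivative (\<lambda>h. (0, h))) (at (0::complex))"
      by (auto intro!: derivative_eq_intros)
    from has_derivative_compose[OF this d] have
      "((\<lambda>v. snd (local_field hesse m e f (0, v))) has_derivative (\<lambda>h. snd (c * 0, c * h))) (at 0)"
      by (intro has_derivative_snd) (simp add: case_prod_unfold)
    then show ?thesis by (simp add: local_field_def has_field_derivative_def)
  qed
  have "c = J e f" using DERIV_unique[OF 1 J] .
  moreover have "c = - J f e" using DERIV_unique[OF 2 DERIV_minus[OF J]] .
  moreover have "J e f = J f e"
    using assms unfolding J_def by algebra
  ultimately show False using c by (simp add: eq_neg_iff_add_eq_0)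
qed

lemma scalar_product_smult: "scalar_product l (c *s m) = c * scalar_product l m" for l :: "complex^3"
  by (simp add: scalar_product_def sum_3 algebra_simps)

lemma proj_pt_eqD:
  assumes "proj_pt m = proj_pt m'"
  shows "\<exists>c. m = c *s m'"
proof -
  have "m \<in> proj_pt m'" using assms vec.span_base[of m "{m}"] by (simp add: proj_pt_def)
  then show ?thesis by (auto simp: proj_pt_def vec.span_singleton)
qed

lemma proj_pt_scale: "c \<noteq> 0 \<Longrightarrow> proj_pt (c *s m) = proj_pt m"
  unfolding proj_pt_def vec.span_singleton
  by (auto simp: image_iff) (metis divide_inverse nonzero_eq_divide_eq vector_smult_assoc)

lemma card_cube_roots_1: "card {w :: complex. w ^ 3 = 1} = 3"
  using card_roots_unity_eq[of 3] by simp

lemma card_sings_on_line: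
  assumes line: "\<And>m. scalar_product l m = 0 \<longleftrightarrow> (\<exists>s t. m = s *s u + t *s v)"
    and indep: "\<And>s t. s *s u + t *s v = 0 \<Longrightarrow> s = 0 \<and> t = 0"
    and sing: "\<And>s t. \<Omega> (s *s u + t *s v) = 0 \<longleftrightarrow> s = 0 \<or> s ^ 3 = t ^ 3"
  shows "card (line_points l \<inter> sings \<Omega>) = 4"
proof -
  define g where "g w = proj_pt (u + w *s v)" for w
  have comb: "s = s' \<and> t = t'" if "s *s u + t *s v = s' *s u + t' *s v" for s t s' t'
  proof -
    have "(s - s') *s u + (t - t') *s v = 0"
      using that by (simp add: vec_eq_iff algebra_simps)
    then show ?thesis using indep by fastforce
  qed
  have "inj g"
  proof (rule injI)
    fix w w' assume "g w = g w'"
    then obtain c where "u + w *s v = c *s (u + w' *s v)" unfolding g_def using proj_pt_eqD by blast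
    then have "1 *s u + w *s v = c *s u + (c * w') *s v" by (simp add: vec_eq_iff algebra_simps)
    then show "w = w'" using comb by fastforce
  qed
  then have card3: "card (g ` {w. w ^ 3 = 1}) = 3"
    using card_image[of g "{w. w ^ 3 = 1}"] inj_on_subset card_cube_roots_1 by force
  have notin: "proj_pt v \<notin> g ` {w. w ^ 3 = 1}"
  proof
    assume "proj_pt v \<in> g ` {w. w ^ 3 = 1}"
    then obtain w c where "u + w *s v = c *s v" using proj_pt_eqD by (metis g_def imageE)
    then have "1 *s u + w *s v = 0 *s u + c *s v" by simp
    then show False using comb by fastforce
  qed
  have eq: "line_points l \<inter> sings \<Omega> = insert (proj_pt v) (g ` {w. w ^ 3 = 1})"
  proof (intro equalityI subsetI)
    fix X assume "X \<in> line_points l \<inter> sings \<Omega>"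
    then obtain m m' where m: "X = proj_pt m" "m \<noteq> 0" "scalar_product l m = 0"
      and m': "X = proj_pt m'" "m' \<noteq> 0" "\<Omega> m' = 0"
      by (auto simp: line_points_def sings_def)
    obtain c where "m' = c *s m" using m m' proj_pt_eqD by metis
    then have "scalar_product l m' = 0" using m(3) by (simp add: scalar_product_smult)
    then obtain s t where st: "m' = s *s u + t *s v" using line by blast
    show "X \<in> insert (proj_pt v) (g ` {w. w ^ 3 = 1})"
    proof (cases "s = 0")
      case True
      then have "m' = t *s v" "t \<noteq> 0" using st m' by auto
      then show ?thesis using m' proj_pt_scale by simp
    next
      case False
      then have "s ^ 3 = t ^ 3" using sing m' st by blast
      then have w: "(t / s) ^ 3 = 1" using False unfolding power_divide by (metis divide_self power_not_zero)
      have "m' = s *s (u + (t / s) *s v)" using False st by (simp add: vec_eq_iff distrib_left)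
      then have "X = g (t / s)" using m'(1) proj_pt_scale[OF False] unfolding g_def by metis
      then show ?thesis using w by blast
    qed
  next
    fix X assume "X \<in> insert (proj_pt v) (g ` {w. w ^ 3 = 1})"
    then consider "X = proj_pt v" | w where "X = proj_pt (u + w *s v)" "w ^ 3 = 1" by (auto simp: g_def)
    then show "X \<in> line_points l \<inter> sings \<Omega>"
    proof cases
      case 1
      have "v \<noteq> 0" using indep[of 0 1] by auto
      moreover have "scalar_product l v = 0" using line[of v] by (metis add_0 vector_smult_lzero vector_smult_lid)
      moreover have "\<Omega> v = 0" using sing[of 0 1] by simp
      ultimately show ?thesis using 1 by (auto simp: line_points_def sings_def)
    next
      case (2 w)
      have "u + w *s v \<noteq> 0" using indep[of 1 w] by auto
      moreover have "scalar_product l (u + w *s v) = 0" using line[of "u + w *s v"] by (metis vector_smult_lid)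
      moreover have "\<Omega> (u + w *s v) = 0" using sing[of 1 w] 2 by simp
      ultimately show ?thesis using 2 by (auto simp: line_points_def sings_def)
    qed
  qed
  show ?thesis
    unfolding eq using card3 notin card.infinite by (subst card_insert_disjoint) fastforce+
qed

lemma no_radial_on_line:
  assumes "\<And>m. scalar_product l m = 0 \<Longrightarrow> hesse m = 0 \<Longrightarrow>
      m$3 * (m$2 ^ 3 - m$1 ^ 3) = 0 \<and> m$1 * (m$3 ^ 3 - m$2 ^ 3) = 0 \<and> m$2 * (m$1 ^ 3 - m$3 ^ 3) = 0"
  shows "line_points l \<inter> radial_sings hesse = {}"
proof -
  have False if eq: "proj_pt m = proj_pt m'" and "scalar_product l m = 0" and rad: "radial_at hesse m'" for m m'
  proof -
    obtain c where "m' = c *s m" using proj_pt_eqD[OF eq[symmetric]] by blast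
    then have "scalar_product l m' = 0" using that(2) by (simp add: scalar_product_smult)
    moreover have "hesse m' = 0" using that(3) by (simp add: radial_at_def)
    ultimately show False using assms curl_free_not_radial that(3) by blast
  qed
  then show ?thesis by (auto simp: line_points_def radial_sings_def)
qed

text \<open>The cubes of \<open>m$b\<close> and \<open>m$c\<close> agree on such a line, so every
  component of the form is, up to a constant, a monomial times
  \<open>m$b ^ 3 - m$a ^ 3\<close>.\<close>

lemma hesse_eq_0_on_harmonic:
  assumes "{a, b, c} = UNIV" "k ^ 3 = 1" "m$c = k * m$b"
  shows "hesse m = 0 \<longleftrightarrow> m$b = 0 \<or> m$b ^ 3 = m$a ^ 3"
proof -
  have k0: "k \<noteq> 0" using assms(2) by auto
  have c3: "m$c ^ 3 = m$b ^ 3" using assms(2,3) by (simp add: power_mult_distrib)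
  have "hesse m = 0 \<longleftrightarrow> m$b * m$c * (2 * m$a ^ 3 - m$b ^ 3 - m$c ^ 3) = 0 \<and>
      m$a * m$c * (2 * m$b ^ 3 - m$a ^ 3 - m$c ^ 3) = 0 \<and> m$a * m$b * (2 * m$c ^ 3 - m$a ^ 3 - m$b ^ 3) = 0"
    unfolding vec3_eq_0_iff hesse_nth using UNIV_3_cases[OF assms(1)]
    by (elim disjE conjE; hypsubst; simp only: diff_diff_eq add.commute mult_ac conj_ac)
  also have "\<dots> \<longleftrightarrow> m$b = 0 \<or> m$b ^ 3 = m$a ^ 3"
    unfolding c3 using k0 assms(3) by auto
  finally show ?thesis .
qed

text \<open>The three families of harmonic polars are exchanged by permutations of the coordinates;
  indices \<open>a\<close>, \<open>b\<close>, \<open>c\<close> in arbitrary order treat them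
  together.\<close>

lemma harmonic_line_perm:
  assumes abc: "{a, b, c} = UNIV" and l: "l$a = 0" "l$b ^ 3 + l$c ^ 3 = 0" "l \<noteq> 0"
  shows "card (line_points l \<inter> sings hesse) = 4 \<and> line_points l \<inter> radial_sings hesse = {}"
proof -
  note perm = UNIV_3_cases[OF abc]
  have all: "(\<forall>n. P n) \<longleftrightarrow> P a \<and> P b \<and> P c" for P :: "3 \<Rightarrow> bool"
    using perm by (auto simp: forall_3)
  have sum: "(\<Sum>n\<in>UNIV. f n) = f a + f b + f c" for f :: "3 \<Rightarrow> complex"
    using perm by (auto simp: sum_3)
  have ne: "a \<noteq> b" "a \<noteq> c" "b \<noteq> c" using perm by auto
  have lc: "l$c \<noteq> 0" using l by (auto simp: vec_eq_iff all)
  define k where "k = - l$b / l$c"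
  have "(k * l$c) ^ 3 = l$c ^ 3" using l lc by (simp add: k_def neg_eq_iff_add_eq_0)
  then have k: "k ^ 3 = 1" using lc by (simp add: power_mult_distrib)
  have line: "scalar_product l m = 0 \<longleftrightarrow> m$c = k * m$b" for m
  proof -
    have "scalar_product l m = l$c * (m$c - k * m$b)"
      using l lc by (simp add: scalar_product_def sum k_def field_simps)
    then show ?thesis using lc by simp
  qed
  \<comment> \<open>\<open>v\<close> is the coordinate vertex on the line, itself a singularity, and
    \<open>u\<close> is the intersection with the opposite coordinate line. At the other three
    singularities the cubes of all coordinates agree.\<close>
  define u v :: "complex^3" where "u = (\<chi> n. if n = a then 0 else if n = b then 1 else k)"
    and "v = (\<chi> n. if n = a then 1 else 0)"
  have uv: "(s *s u + t *s v) $ a = t" "(s *s u + t *s v) $ b = s" "(s *s u + t *s v) $ c = s * k" for s t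
    using ne by (simp_all add: u_def v_def)
  have "card (line_points l \<inter> sings hesse) = 4"
  proof (rule card_sings_on_line)
    fix m show "scalar_product l m = 0 \<longleftrightarrow> (\<exists>s t. m = s *s u + t *s v)"
      unfolding line vec_eq_iff all uv by (auto simp: mult.commute)
  next
    fix s t assume 0: "s *s u + t *s v = 0"
    show "s = 0 \<and> t = 0" using uv(1,2)[of s t] unfolding 0 by simp
  next
    fix s t show "hesse (s *s u + t *s v) = 0 \<longleftrightarrow> s = 0 \<or> s ^ 3 = t ^ 3"
      using hesse_eq_0_on_harmonic[OF abc k, of "s *s u + t *s v"] unfolding uv by (simp add: mult.commute)
  qed
  moreover have "line_points l \<inter> radial_sings hesse = {}"
  proof (rule no_radial_on_line)
    fix m assume m: "scalar_product l m = 0" "hesse m = 0"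
    then have c: "m$c = k * m$b" and b: "m$b = 0 \<or> m$b ^ 3 = m$a ^ 3"
      using line hesse_eq_0_on_harmonic[OF abc k] by auto
    have c3: "m$c ^ 3 = m$b ^ 3" using c k by (simp add: power_mult_distrib)
    show "m$3 * (m$2 ^ 3 - m$1 ^ 3) = 0 \<and> m$1 * (m$3 ^ 3 - m$2 ^ 3) = 0 \<and> m$2 * (m$1 ^ 3 - m$3 ^ 3) = 0"
      using b
    proof
      assume "m$b = 0"
      with c show ?thesis using perm by auto
    next
      assume "m$b ^ 3 = m$a ^ 3"
      with c3 show ?thesis using perm by auto
    qed
  qed
  ultimately show ?thesis ..
qed

lemma harmonic_line:
  assumes "harmonic_polar l" "l \<noteq> 0"
  shows "card (line_points l \<inter> sings hesse) = 4 \<and> line_points l \<inter> radial_sings hesse = {}"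
  using assms(1) harmonic_line_perm[of 1 2 3 l] harmonic_line_perm[of 2 1 3 l] harmonic_line_perm[of 3 1 2 l] assms(2)
  by (auto simp: harmonic_polar_def UNIV_3 insert_commute)

theorem propositionG:
  fixes l :: "complex^3"
  assumes "l \<noteq> 0"
    and "\<not> invariant_line hesse l"
    and "flat_web 5 (Leg l hesse)"
  shows "card (line_points l \<inter> sings hesse) = 4 \<and> line_points l \<inter> radial_sings hesse = {}"
  using flat_imp_harmonic harmonic_line assms by blast

end
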